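(* Let $\Theta=(a,b)$ with $-\infty\le a<b\le\infty$, let $\{f(\cdot|\theta):\theta\in\Theta\}$ be a family of probability density (or mass) functions on $\mathbb{R}$, let $\theta_0\in\Theta$ be the true value of the parameter, and let $X_1,X_2,\ldots$ be i.i.d. random variables with density (or mass function) $f(\cdot|\theta_0)$. For $n\ge 1$ write $\boldsymbol{X}=(X_1,\ldots,X_n)$. Assume that (A1)-(A3) (for every sample size $n$) and (R1)-(R4), as listed in the context, are satisfied, so that the maximum likelihood estimator $\hat\theta_n(\boldsymbol{X})$ exists and is unique. Let $q:\Theta\to\mathbb{R}$ be a one-to-one twice differentiable function with $q'(\theta)\neq 0$ for all $\theta\in\Theta$, and let $g:\mathbb{R}\to\mathbb{R}$ be a function (both not depending on $n$) such that $$q\left(\hat\theta_n(\boldsymbol{X})\right)=\frac1n\sum_{i=1}^n g(X_i)\qquad\text{for every } n\ge 1,$$ and $\mathrm{E}\left[|g(X_1)-q(\theta_0)|^3\right]<\infty$. Let $\epsilon=\epsilon(\theta_0)>0$ be a constant as in (R3) with $(\theta_0-\epsilon,\theta_0+\epsilon)\subset\Theta$. Let $Z\sim\mathcal{N}(0,1)$. Then for every absolutely continuous and bounded function $h:\mathbb{R}\to\mathbb{R}$ and every $n\ge 1$, $$\begin{aligned} &\left|\mathrm{E}\left[h\left(\sqrt{n\,i(\theta_0)}\left(\hat\theta_n(\boldsymbol{X})-\theta_0\right)\right)\right]-\mathrm{E}[h(Z)]\right|\\ &\le \frac{\|h'\|}{\sqrt n}\left(2+\frac{[i(\theta_0)]^{3/2}}{|q'(\theta_0)|^3}\,\mathrm{E}\left[|g(X_1)-q(\theta_0)|^3\right]\right)\\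 &\quad+\mathrm{E}\left[\left(\hat\theta_n(\boldsymbol{X})-\theta_0\right)^2\right]\left(2\frac{\|h\|}{\epsilon^2}\,\mathbf{1}\{\exists\,\theta\in\Theta:\ q(\theta)\neq\theta\}+\frac{\|h'\|\sqrt{n\,i(\theta_0)}}{2|q'(\theta_0)|}\sup_{\theta:|\theta-\theta_0|\le\epsilon}|q''(\theta)|\right). \end{aligned}$$
   Context: Notation. For data $\boldsymbol{x}=(x_1,\ldots,x_n)$, the likelihood is $L(\theta;\boldsymbol{x})=f(\boldsymbol{x}|\theta)=\prod_{i=1}^n f(x_i|\theta)$ and the log-likelihood is $l(\theta;\boldsymbol{x})=\log L(\theta;\boldsymbol{x})$; $l',l''$ denote derivatives with respect to $\theta$. $\hat\theta_n(\boldsymbol{x})$ is the maximizer of $\theta\mapsto l(\theta;\boldsymbol{x})$ over $\Theta$ (the MLE). $i(\theta)$ is the expected Fisher information of one observation, i.e. $i(\theta)=\mathrm{E}_\theta\left[\left(\frac{\mathrm{d}}{\mathrm{d}\theta}\log f(X_1|\theta)\right)^2\right]$. $\mathbb{X}$ denotes the support of $f(\cdot|\theta)$. $\mathrm{E}$ is expectation under $\theta_0$. $\|\cdot\|$ is the (essential) supremum norm; $h'$ is the a.e. derivative of $h$. The right-hand side may be $+\infty$. Suprema over $\{\theta:|\theta-\theta_0|\le\epsilon\}$ are over $\theta\in\Theta$. $\mathbf{1}\{\cdot\}$ is the indicator (1 if the condition holds, 0 otherwise). Conditions on the log-likelihood (for every data vector $\boldsymbol{x}\in\mathbb{X}^n$):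 (A1) $l(\theta;\boldsymbol{x})$ is twice continuously differentiable in $\theta$, and $\theta$ varies in the open interval $(a,b)$, $a,b\in\mathbb{R}\cup\{-\infty,\infty\}$, $a<b$; (A2) $\lim_{\theta\to a}l(\theta;\boldsymbol{x})=\lim_{\theta\to b}l(\theta;\boldsymbol{x})=-\infty$; (A3) $l''(\theta;\boldsymbol{x})<0$ at every $\theta\in(a,b)$ with $l'(\theta;\boldsymbol{x})=0$. Regularity conditions: (R1) the parameter is identifiable: if $\theta\ne\theta'$ then there is $x$ with $f(x|\theta)\ne f(x|\theta')$; (R2) $f(x|\theta)$ is three times differentiable in $\theta$, the third derivative is continuous in $\theta$, and $\int f(x|\theta)\,\mathrm{d}x$ (a sum in the discrete case) can be differentiated three times under the integral sign; (R3) for any $\theta_0\in\Theta$ there exist $\epsilon>0$ and a function $M(x)$ (both possibly depending on $\theta_0$) such that $\left|\frac{\mathrm{d}^3}{\mathrm{d}\theta^3}\log f(x|\theta)\right|\le M(x)$ for all $x\in\mathbb{X}$ and $\theta_0-\epsilon<\theta<\theta_0+\epsilon$, with $\mathrm{E}_{\theta_0}[M(X_1)]<\infty$; (R4) $i(\theta)>0$ for all $\theta\in\Theta$. *)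

theory Defs
  imports "HOL-Probability.Probability"
begin

text \<open>Throughout, \<open>f \<theta> x\<close> stands for $f(x|\theta)$, and a sample of size \<open>n\<close> is given by the
  entries \<open>x 0, \<dots>, x (n - 1)\<close> of a sequence \<open>x\<close>.\<close>

text \<open>Either Lebesgue measure (densities) or counting measure on a countable support (mass
  functions). The latter is transported to the Borel sets of the line, so that integrals against it
  are sums over \<open>\<X>\<close> while random variables are only required to be Borel measurable.\<close>

definition reference_measure :: "real measure \<Rightarrow> real set \<Rightarrow> bool" where
  "reference_measure \<nu> \<X> \<longleftrightarrow>
     \<nu> = lborel \<or> (countable \<X> \<and> \<nu> = distr (count_space \<X>) borel (\<lambda>x. x))"

definition density_family ::
  "real measure \<Rightarrow> real set \<Rightarrow> real set \<Rightarrow> (real \<Rightarrow> real \<Rightarrow> real) \<Rightarrow> bool" where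
  "density_family \<nu> \<Theta> \<X> f \<longleftrightarrow>
     reference_measure \<nu> \<X> \<and>
     (\<forall>\<theta>\<in>\<Theta>. f \<theta> \<in> borel_measurable borel \<and>
            (\<forall>x. f \<theta> x \<ge> 0) \<and>
            {x. f \<theta> x > 0} = \<X> \<and>
            (\<integral>\<^sup>+ x. ennreal (f \<theta> x) \<partial>\<nu>) = 1)"

definition law :: "real measure \<Rightarrow> (real \<Rightarrow> real \<Rightarrow> real) \<Rightarrow> real \<Rightarrow> real measure" where
  "law \<nu> f \<theta> = density \<nu> (\<lambda>x. ennreal (f \<theta> x))"

definition likelihood :: "(real \<Rightarrow> real \<Rightarrow> real) \<Rightarrow> nat \<Rightarrow> (nat \<Rightarrow> real) \<Rightarrow> real \<Rightarrow> real" where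
  "likelihood f n x \<theta> = (\<Prod>i<n. f \<theta> (x i))"

definition log_likelihood :: "(real \<Rightarrow> real \<Rightarrow> real) \<Rightarrow> nat \<Rightarrow> (nat \<Rightarrow> real) \<Rightarrow> real \<Rightarrow> real" where
  "log_likelihood f n x \<theta> = ln (likelihood f n x \<theta>)"

text \<open>Only data in \<open>\<X>\<^sup>n\<close> matter. The fixed value elsewhere keeps the estimator measurable on the
  null event that some observation falls outside the support.\<close>

definition mle ::
  "(real \<Rightarrow> real \<Rightarrow> real) \<Rightarrow> real set \<Rightarrow> real set \<Rightarrow> nat \<Rightarrow> (nat \<Rightarrow> real) \<Rightarrow> real" where
  "mle f \<Theta> \<X> n x =
     (if x \<in> {..<n} \<rightarrow> \<X> then arg_max_on (log_likelihood f n x) \<Theta> else undefined)"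

text \<open>The Bochner integral is \<open>0\<close> for a non-integrable integrand, hence positivity of the Fisher
  information includes its finiteness.\<close>

definition fisher_info :: "real measure \<Rightarrow> (real \<Rightarrow> real \<Rightarrow> real) \<Rightarrow> real \<Rightarrow> real" where
  "fisher_info \<nu> f \<theta> = (\<integral>x. (deriv (\<lambda>t. ln (f t x)) \<theta>)\<^sup>2 \<partial>law \<nu> f \<theta>)"

definition times_differentiable_on :: "nat \<Rightarrow> (real \<Rightarrow> real) \<Rightarrow> real set \<Rightarrow> bool" where
  "times_differentiable_on k F S \<longleftrightarrow> (\<forall>j<k. \<forall>t\<in>S. (deriv ^^ j) F differentiable (at t))"

definition cond_A1 :: "(real \<Rightarrow> real \<Rightarrow> real) \<Rightarrow> real set \<Rightarrow> nat \<Rightarrow> (nat \<Rightarrow> real) \<Rightarrow> bool" where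
  "cond_A1 f \<Theta> n x \<longleftrightarrow>
     times_differentiable_on 2 (log_likelihood f n x) \<Theta> \<and>
     continuous_on \<Theta> ((deriv ^^ 2) (log_likelihood f n x))"

text \<open>The limits are taken in the extended reals, so that infinite end points are covered.\<close>

definition cond_A2 :: "(real \<Rightarrow> real \<Rightarrow> real) \<Rightarrow> ereal \<Rightarrow> ereal \<Rightarrow> nat \<Rightarrow> (nat \<Rightarrow> real) \<Rightarrow> bool" where
  "cond_A2 f a b n x \<longleftrightarrow>
     filterlim (log_likelihood f n x \<circ> real_of_ereal) at_bot (at_right a) \<and>
     filterlim (log_likelihood f n x \<circ> real_of_ereal) at_bot (at_left b)"

definition cond_A3 :: "(real \<Rightarrow> real \<Rightarrow> real) \<Rightarrow> real set \<Rightarrow> nat \<Rightarrow> (nat \<Rightarrow> real) \<Rightarrow> bool" where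
  "cond_A3 f \<Theta> n x \<longleftrightarrow>
     (\<forall>\<theta>\<in>\<Theta>. deriv (log_likelihood f n x) \<theta> = 0 \<longrightarrow>
            (deriv ^^ 2) (log_likelihood f n x) \<theta> < 0)"

definition cond_R1 :: "(real \<Rightarrow> real \<Rightarrow> real) \<Rightarrow> real set \<Rightarrow> bool" where
  "cond_R1 f \<Theta> \<longleftrightarrow> (\<forall>\<theta>\<in>\<Theta>. \<forall>\<theta>'\<in>\<Theta>. \<theta> \<noteq> \<theta>' \<longrightarrow> (\<exists>x. f \<theta> x \<noteq> f \<theta>' x))"

definition cond_R2 :: "real measure \<Rightarrow> (real \<Rightarrow> real \<Rightarrow> real) \<Rightarrow> real set \<Rightarrow> bool" where
  "cond_R2 \<nu> f \<Theta> \<longleftrightarrow>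
     (\<forall>x. times_differentiable_on 3 (\<lambda>t. f t x) \<Theta> \<and>
          continuous_on \<Theta> ((deriv ^^ 3) (\<lambda>t. f t x))) \<and>
     (\<forall>j<3. \<forall>\<theta>\<in>\<Theta>.
        integrable \<nu> (\<lambda>x. (deriv ^^ Suc j) (\<lambda>t. f t x) \<theta>) \<and>
        ((\<lambda>s. \<integral>x. (deriv ^^ j) (\<lambda>t. f t x) s \<partial>\<nu>) has_real_derivative
           (\<integral>x. (deriv ^^ Suc j) (\<lambda>t. f t x) \<theta> \<partial>\<nu>)) (at \<theta>))"

text \<open>\<open>R3_radius \<nu> f \<Theta> \<X> \<theta>\<^sub>0 \<epsilon>\<close>: the number \<open>\<epsilon>\<close> can serve as the constant that condition (R3)
  provides at \<open>\<theta>\<^sub>0\<close>.\<close>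

definition R3_radius ::
  "real measure \<Rightarrow> (real \<Rightarrow> real \<Rightarrow> real) \<Rightarrow> real set \<Rightarrow> real set \<Rightarrow> real \<Rightarrow> real \<Rightarrow> bool" where
  "R3_radius \<nu> f \<Theta> \<X> \<theta>\<^sub>0 \<epsilon> \<longleftrightarrow>
     \<epsilon> > 0 \<and>
     (\<exists>M. integrable (law \<nu> f \<theta>\<^sub>0) M \<and>
          (\<forall>x\<in>\<X>. \<forall>\<theta>\<in>\<Theta>. \<theta>\<^sub>0 - \<epsilon> < \<theta> \<and> \<theta> < \<theta>\<^sub>0 + \<epsilon> \<longrightarrow>
             \<bar>(deriv ^^ 3) (\<lambda>t. ln (f t x)) \<theta>\<bar> \<le> M x))"

definition cond_R3 ::
  "real measure \<Rightarrow> (real \<Rightarrow> real \<Rightarrow> real) \<Rightarrow> real set \<Rightarrow> real set \<Rightarrow> bool" where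
  "cond_R3 \<nu> f \<Theta> \<X> \<longleftrightarrow> (\<forall>\<theta>\<^sub>0\<in>\<Theta>. \<exists>\<epsilon>. R3_radius \<nu> f \<Theta> \<X> \<theta>\<^sub>0 \<epsilon>)"

definition cond_R4 :: "real measure \<Rightarrow> (real \<Rightarrow> real \<Rightarrow> real) \<Rightarrow> real set \<Rightarrow> bool" where
  "cond_R4 \<nu> f \<Theta> \<longleftrightarrow> (\<forall>\<theta>\<in>\<Theta>. fisher_info \<nu> f \<theta> > 0)"

definition abs_continuous_on :: "real set \<Rightarrow> (real \<Rightarrow> real) \<Rightarrow> bool" where
  "abs_continuous_on S h \<longleftrightarrow>
     (\<forall>e>0. \<exists>d>0. \<forall>(m::nat) u v.
        (\<forall>k<m. u k \<le> v k \<and> {u k..v k} \<subseteq> S) \<and>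
        disjoint_family_on (\<lambda>k. {u k<..<v k}) {..<m} \<and>
        (\<Sum>k<m. v k - u k) < d \<longrightarrow>
        (\<Sum>k<m. \<bar>h (v k) - h (u k)\<bar>) < e)"

text \<open>Absolute continuity on the line is understood on every compact interval.\<close>

definition abs_continuous :: "(real \<Rightarrow> real) \<Rightarrow> bool" where
  "abs_continuous h \<longleftrightarrow> (\<forall>c d. abs_continuous_on {c..d} h)"

definition ess_norm :: "(real \<Rightarrow> real) \<Rightarrow> ennreal" where
  "ess_norm F = esssup lebesgue (\<lambda>x. ennreal \<bar>F x\<bar>)"

end

theory Submission
  imports Defs
begin

text \<open>
  Write \<open>i\<close> for the Fisher information at \<open>\<theta>\<^sub>0\<close> and \<open>T\<close> for the estimator. The averages \<open>q T\<close> are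
  sums of i.i.d. variables, so Stein's method applies to them directly, and a Taylor expansion of
  \<open>q\<close> at \<open>\<theta>\<^sub>0\<close> carries the bound over to \<open>T\<close>. Two points need an idea.

  First, the summands \<open>sqrt i / q' \<theta>\<^sub>0 * (g X - q \<theta>\<^sub>0)\<close> have to have mean 0 and variance 1. This
  follows from the form of the estimator at all sample sizes. By the conditions
  on the log-likelihood, \<open>T > \<theta>\<close> holds exactly when the score sum \<open>\<Sum> s\<^sub>\<theta> (X\<^sub>i)\<close> is positive. If,
  say, \<open>q\<close> is increasing, \<open>T > \<theta>\<close> also holds exactly when \<open>\<Sum> (g (X\<^sub>i) - q \<theta>)\<close> is positive. Hence
  the random walks with steps \<open>s\<^sub>\<theta> (X\<^sub>i)\<close> and \<open>g (X\<^sub>i) - q \<theta>\<close> have the same sign at all times, and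
  two such walks have proportional steps (\<open>proportional_of_equal_signs\<close>): a pair of values with
  different ratios could be repeated \<open>m\<close> and \<open>k\<close> times so that the two sums get opposite signs.
  So \<open>s\<^sub>\<theta> = c \<theta> * (g - q \<theta>)\<close>; differentiating in \<open>\<theta>\<close> at \<open>\<theta>\<^sub>0\<close> and taking expectations, the
  identity \<open>E s' = - i\<close> gives \<open>i = c \<theta>\<^sub>0 * q' \<theta>\<^sub>0\<close> (\<open>score_proportional_at_true_value\<close>). So the
  summands equal the score at \<open>\<theta>\<^sub>0\<close> divided by \<open>sqrt i\<close>, which has mean 0 and variance 1.

  Second, the factor \<open>2 + E |Y|^3\<close> requires, for an \<open>L\<close>-Lipschitz function \<open>h\<close>, a solution
  \<open>F\<close> of the Stein equation such that \<open>F'\<close> is \<open>2 L\<close>-Lipschitz. Since \<open>F' x = x * F x + h x - E h\<close>,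
  it is enough that \<open>x * F x\<close> is \<open>L\<close>-Lipschitz. Its derivative is linear in \<open>h - h x\<close>, with
  coefficients on the two half lines whose signs are known. The extremal case is therefore
  \<open>h t = L * |t - x|\<close>, for which the resulting bound is exactly \<open>L\<close> (\<open>stein_solution\<close>).

  A function \<open>h\<close> that is absolutely continuous with \<open>|h'| \<le> L\<close> almost everywhere is
  \<open>L\<close>-Lipschitz (\<open>abs_continuous_imp_lipschitz\<close>), which connects the essential norm of \<open>h'\<close> with the
  Lipschitz constant used everywhere else. For the passage from \<open>q T\<close> to \<open>T\<close>, values of \<open>T\<close> with
  \<open>|T - \<theta>\<^sub>0| \<ge> \<epsilon>\<close> are treated by Chebyshev's estimate and the others by the second order
  Taylor formula; both give a multiple of \<open>(T - \<theta>\<^sub>0)\<^sup>2\<close> (\<open>delta_method_pointwise\<close>).\<close>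

section \<open>Almost everywhere bounded derivatives of absolutely continuous functions\<close>

text \<open>Choose a tagged division of the interval that is so fine that a piece tagged outside
  the exceptional null set obeys the derivative bound, while the pieces tagged inside it lie in an
  open set of measure less than the \<open>d\<close> that absolute continuity assigns to \<open>e\<close>. The former contribute at most
  \<open>(L + e) * (y - x)\<close> to the increment and the latter less than \<open>e\<close>.\<close>

lemma abs_continuous_deriv_bound_le:
  fixes h h' :: "real \<Rightarrow> real"
  assumes ac: "abs_continuous h"
    and der: "AE x in lborel. (h has_real_derivative h' x) (at x)"
    and bd: "AE x in lborel. \<bar>h' x\<bar> \<le> L"
    and xy: "x < y" and e: "e > 0"
  shows "\<bar>h y - h x\<bar> \<le> (L + e) * (y - x) + e"
proof -
  have "AE t in lborel. (h has_real_derivative h' t) (at t) \<and> \<bar>h' t\<bar> \<le> L"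
    using der bd by eventually_elim auto
  then obtain N where N: "N \<in> null_sets lborel"
    and sub: "{t. \<not> ((h has_real_derivative h' t) (at t) \<and> \<bar>h' t\<bar> \<le> L)} \<subseteq> N"
    by (rule AE_E3) auto
  from ac have "abs_continuous_on {x..y} h" by (simp add: abs_continuous_def)
  then obtain d where d: "d > 0" and ac': "\<And>(m::nat) u v.
        (\<forall>k<m. u k \<le> v k \<and> {u k..v k} \<subseteq> {x..y}) \<Longrightarrow>
        disjoint_family_on (\<lambda>k. {u k<..<v k}) {..<m} \<Longrightarrow>
        (\<Sum>k<m. v k - u k) < d \<Longrightarrow> (\<Sum>k<m. \<bar>h (v k) - h (u k)\<bar>) < e"
    using e unfolding abs_continuous_on_def by meson
  have "N \<in> sets borel" using N by (auto simp: null_sets_def)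
  then obtain U where U: "open U" "N \<subseteq> U" "emeasure lborel (U - N) < ennreal d"
    using outer_regular_lborel[of N d] d by blast
  have Um: "emeasure lborel U < ennreal d"
    using U(3) emeasure_Diff_null_set[OF N, of U] U(1) by auto
  have "\<exists>r>0. (t \<in> N \<longrightarrow> ball t r \<subseteq> U) \<and>
      (t \<notin> N \<longrightarrow> (\<forall>u v. u \<le> t \<and> t \<le> v \<and> u \<in> ball t r \<and> v \<in> ball t r
          \<longrightarrow> \<bar>h v - h u\<bar> \<le> (L + e) * (v - u)))" for t
  proof (cases "t \<in> N")
    case True
    then show ?thesis using U by (auto simp: open_contains_ball)
  next
    case False
    with sub have D: "(h has_real_derivative h' t) (at t)" and B: "\<bar>h' t\<bar> \<le> L" by auto
    from D e obtain r where r: "r > 0"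
      and r': "\<And>z. \<bar>z - t\<bar> < r \<Longrightarrow> \<bar>h z - h t - (z - t) * h' t\<bar> \<le> e * \<bar>z - t\<bar>"
      unfolding has_field_derivative_def has_derivative_at_alt
      by (auto simp: ac_simps)
    have K: "\<bar>h z - h t\<bar> \<le> (L + e) * \<bar>z - t\<bar>" if "\<bar>z - t\<bar> < r" for z
    proof -
      have "\<bar>h z - h t\<bar> \<le> \<bar>h z - h t - (z - t) * h' t\<bar> + \<bar>z - t\<bar> * \<bar>h' t\<bar>"
        by (simp flip: abs_mult)
      also have "\<dots> \<le> e * \<bar>z - t\<bar> + \<bar>z - t\<bar> * L"
        using r'[OF that] B by (intro add_mono mult_left_mono) auto
      finally show ?thesis by (simp add: algebra_simps)
    qed
    have "\<bar>h v - h u\<bar> \<le> (L + e) * (v - u)"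
      if "u \<le> t" "t \<le> v" "u \<in> ball t r" "v \<in> ball t r" for u v
    proof -
      have "\<bar>h v - h u\<bar> \<le> \<bar>h v - h t\<bar> + \<bar>h u - h t\<bar>" by simp
      also have "\<dots> \<le> (L + e) * (v - t) + (L + e) * (t - u)"
        using K[of v] K[of u] that by (auto simp: dist_real_def abs_minus_commute)
      finally show ?thesis by (simp add: algebra_simps)
    qed
    with r False show ?thesis by (intro exI[of _ r]) blast
  qed
  then obtain r where r: "\<And>t. r t > 0" "\<And>t. t \<in> N \<Longrightarrow> ball t (r t) \<subseteq> U"
    and rB: "\<And>t u v. t \<notin> N \<Longrightarrow> u \<le> t \<Longrightarrow> t \<le> v \<Longrightarrow> u \<in> ball t (r t) \<Longrightarrow> v \<in> ball t (r t)
        \<Longrightarrow> \<bar>h v - h u\<bar> \<le> (L + e) * (v - u)"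
    by metis
  obtain p where p: "p tagged_division_of {x..y}" "(\<lambda>t. ball t (r t)) fine p"
    using fine_division_exists_real[OF gauge_ball_dependent] r(1) by blast
  note pD = tagged_division_ofD[OF p(1)]
  have K: "\<exists>u v. K = {u..v} \<and> u \<le> t \<and> t \<le> v \<and> Inf K = u \<and> Sup K = v \<and> {u..v} \<subseteq> {x..y} \<and>
      {u..v} \<subseteq> ball t (r t)" if tK: "(t, K) \<in> p" for t K
  proof -
    obtain u v where uv: "K = {u..v}" using pD(4)[OF tK] by (auto simp: box_real)
    have "t \<in> K" "K \<subseteq> {x..y}" using pD(2,3)[OF tK] by auto
    moreover have "K \<subseteq> ball t (r t)" using p(2) tK by (auto simp: fine_def)
    ultimately show ?thesis using uv by (intro exI[of _ u] exI[of _ v]) auto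
  qed
  define A where "A = {z\<in>p. fst z \<in> N}"
  define l where "l z = Inf (snd z)" for z :: "real \<times> real set"
  define s where "s z = Sup (snd z)" for z :: "real \<times> real set"
  have z: "snd z = {l z..s z} \<and> l z \<le> fst z \<and> fst z \<le> s z \<and> {l z..s z} \<subseteq> {x..y} \<and>
      {l z..s z} \<subseteq> ball (fst z) (r (fst z))" if "z \<in> p" for z
  proof -
    from K[of "fst z" "snd z"] that obtain u v where "snd z = {u..v}" "u \<le> fst z" "fst z \<le> v"
      "Inf (snd z) = u" "Sup (snd z) = v" "{u..v} \<subseteq> {x..y}" "{u..v} \<subseteq> ball (fst z) (r (fst z))"
      by auto
    then show ?thesis unfolding l_def s_def by (metis (no_types))
  qed
  have finp: "finite p" by (rule pD(1))
  have tot: "(\<Sum>z\<in>p. F (s z) - F (l z)) = F y - F x" for F :: "real \<Rightarrow> real"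
    using additive_tagged_division_1[OF less_imp_le[OF xy] p(1), of F]
    by (simp add: l_def s_def case_prod_beta)
  have finA: "finite A" "A \<subseteq> p" using finp by (auto simp: A_def)
  have good: "(\<Sum>z\<in>p-A. \<bar>h (s z) - h (l z)\<bar>) \<le> (L + e) * (y - x)"
  proof -
    have L: "0 \<le> L"
    proof -
      have "N \<noteq> UNIV" using N by (auto simp: null_sets_def emeasure_lborel_UNIV)
      then obtain t where "t \<notin> N" by blast
      with sub have "\<bar>h' t\<bar> \<le> L" by auto
      then show ?thesis by linarith
    qed
    have "(\<Sum>z\<in>p-A. \<bar>h (s z) - h (l z)\<bar>) \<le> (\<Sum>z\<in>p-A. (L + e) * (s z - l z))"
    proof (rule sum_mono)
      fix w assume w: "w \<in> p - A"
      with z[of w] have *: "l w \<in> {l w..s w}" "s w \<in> {l w..s w}" by auto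
      with z[of w] w have "l w \<in> ball (fst w) (r (fst w))" "s w \<in> ball (fst w) (r (fst w))"
        by blast+
      then show "\<bar>h (s w) - h (l w)\<bar> \<le> (L + e) * (s w - l w)"
        using z[of w] w by (intro rB[of "fst w"]) (auto simp: A_def)
    qed
    also have "\<dots> \<le> (\<Sum>z\<in>p. (L + e) * (s z - l z))"
      using z L e finp by (intro sum_mono2) (auto intro!: mult_nonneg_nonneg dest: z)
    also have "\<dots> = (L + e) * (y - x)"
      using tot[of "\<lambda>t. t"] by (simp flip: sum_distrib_left)
    finally show ?thesis .
  qed
  have bad: "(\<Sum>z\<in>A. \<bar>h (s z) - h (l z)\<bar>) < e"
  proof -
    obtain b where b: "bij_betw b {..<card A} A"
      using ex_bij_betw_nat_finite[OF finA(1)] by (auto simp: atLeast0LessThan)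
    have bA: "b k \<in> A" "b k \<in> p" if "k < card A" for k
      using b that finA(2) by (auto simp: bij_betw_def)
    have dis: "disjoint_family_on (\<lambda>k. {l (b k)<..<s (b k)}) {..<card A}"
    proof (unfold disjoint_family_on_def, intro ballI impI)
      fix i j assume ij: "i \<in> {..<card A}" "j \<in> {..<card A}" "i \<noteq> j"
      then have "b i \<noteq> b j" using b by (auto simp: bij_betw_def inj_on_def)
      then have "interior (snd (b i)) \<inter> interior (snd (b j)) = {}"
        using pD(5)[of "fst (b i)" "snd (b i)" "fst (b j)" "snd (b j)"] bA ij
        by (auto simp: prod_eq_iff)
      then show "{l (b i)<..<s (b i)} \<inter> {l (b j)<..<s (b j)} = {}"
        using z[OF bA(2)] ij by (metis interior_atLeastAtMost_real lessThan_iff)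
    qed
    have "ennreal (\<Sum>k<card A. s (b k) - l (b k)) = (\<Sum>k<card A. emeasure lborel {l (b k)<..<s (b k)})"
    proof -
      have "l (b k) \<le> s (b k)" if "k < card A" for k using z[OF bA(2)[OF that]] by auto
      then show ?thesis by (subst sum_ennreal[symmetric]) auto
    qed
    also have "\<dots> = emeasure lborel (\<Union>k<card A. {l (b k)<..<s (b k)})"
      using dis by (intro sum_emeasure) auto
    also have "\<dots> \<le> emeasure lborel U"
    proof (rule emeasure_mono)
      show "(\<Union>k<card A. {l (b k)<..<s (b k)}) \<subseteq> U"
      proof (rule UN_least)
        fix k assume "k \<in> {..<card A}"
        then have "k < card A" by simp
        from z[OF bA(2)[OF this]] bA(1)[OF this]
        have "{l (b k)..s (b k)} \<subseteq> U" using r(2)[of "fst (b k)"] by (auto simp: A_def)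
        then show "{l (b k)<..<s (b k)} \<subseteq> U" by (auto simp: subset_iff)
      qed
    qed (use U in auto)
    also note Um
    finally have "(\<Sum>k<card A. s (b k) - l (b k)) < d"
      by (meson ennreal_leI leI leD)
    moreover have lz: "l (b k) \<le> s (b k) \<and> {l (b k)..s (b k)} \<subseteq> {x..y}" if "k < card A" for k
      using z[OF bA(2)[OF that]] by (meson order_trans)
    ultimately have "(\<Sum>k<card A. \<bar>h (s (b k)) - h (l (b k))\<bar>) < e"
      using lz by (intro ac' dis) blast+
    also have "(\<Sum>k<card A. \<bar>h (s (b k)) - h (l (b k))\<bar>) = (\<Sum>z\<in>A. \<bar>h (s z) - h (l z)\<bar>)"
      by (rule sum.reindex_bij_betw[OF b])
    finally show ?thesis .
  qed
  have "\<bar>h y - h x\<bar> \<le> (\<Sum>z\<in>p. \<bar>h (s z) - h (l z)\<bar>)"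
    unfolding tot[of h, symmetric] by (rule sum_abs)
  also have "\<dots> = (\<Sum>z\<in>p-A. \<bar>h (s z) - h (l z)\<bar>) + (\<Sum>z\<in>A. \<bar>h (s z) - h (l z)\<bar>)"
    using finp finA by (simp add: sum.subset_diff)
  finally show ?thesis using good bad by simp
qed

lemma abs_continuous_imp_lipschitz:
  fixes h h' :: "real \<Rightarrow> real"
  assumes ac: "abs_continuous h"
    and der: "AE x in lborel. (h has_real_derivative h' x) (at x)"
    and bd: "AE x in lborel. \<bar>h' x\<bar> \<le> L"
  shows "\<bar>h y - h x\<bar> \<le> L * \<bar>y - x\<bar>"
proof -
  have *: "\<bar>h y - h x\<bar> \<le> L * (y - x)" if xy: "x < y" for x y
  proof (rule field_le_epsilon)
    fix e :: real assume e: "e > 0"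
    define e' where "e' = e / (y - x + 1)"
    have "e' > 0" using e xy by (simp add: e'_def)
    from abs_continuous_deriv_bound_le[OF ac der bd xy this]
    have "\<bar>h y - h x\<bar> \<le> L * (y - x) + e' * (y - x + 1)" by (simp add: algebra_simps)
    also have "e' * (y - x + 1) = e" using xy by (simp add: e'_def)
    finally show "\<bar>h y - h x\<bar> \<le> L * (y - x) + e" .
  qed
  show ?thesis
    using *[of x y] *[of y x] by (cases x y rule: linorder_cases) (auto simp: abs_minus_commute)
qed

section \<open>Gaussian tails and the solution of the Stein equation\<close>

lemma set_integrable_borel:
  fixes k :: "real \<Rightarrow> real"
  assumes "integrable lborel k" "A \<in> sets borel"
  shows "set_integrable lborel A k"
  unfolding set_integrable_def using integrable_mult_indicator[OF _ assms(1), of A] assms(2) by auto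

lemma set_integral_greaterThan_FTC:
  fixes g G :: "real \<Rightarrow> real"
  assumes G: "\<And>t. (G has_real_derivative g t) (at t)"
    and g: "continuous_on UNIV g" "integrable lborel g"
    and lim: "(G \<longlongrightarrow> 0) at_top"
  shows "(LINT t:{x<..}|lborel. g t) = - G x"
proof -
  have "(LBINT t=ereal x..\<infinity>. g t) = 0 - G x"
  proof (rule interval_integral_FTC_integrable)
    show "set_integrable lborel (einterval (ereal x) \<infinity>) g"
      by (intro set_integrable_borel g) auto
    show "((G \<circ> real_of_ereal) \<longlongrightarrow> G x) (at_right (ereal x))"
      unfolding ereal_tendsto_simps1
      using DERIV_isCont[OF G] by (simp add: isCont_def filterlim_at_split)
    show "((G \<circ> real_of_ereal) \<longlongrightarrow> 0) (at_left \<infinity>)"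
      unfolding ereal_tendsto_simps1 by (rule lim)
    show "isCont g t" for t
      using g(1) by (simp add: continuous_on_eq_continuous_at)
    show "(G has_vector_derivative g t) (at t)" for t
      using G[of t] by (simp add: has_real_derivative_iff_has_vector_derivative)
  qed auto
  also have "(LBINT t=ereal x..\<infinity>. g t) = (LINT t:{x<..}|lborel. g t)"
    by (simp add: interval_lebesgue_integral_def einterval_def greaterThan_def)
  finally show ?thesis by simp
qed

text \<open>The fundamental theorem of calculus on a bounded interval applies once the integral is
  split at a point to the left of \<open>x\<close>.\<close>

lemma set_integral_atMost_has_derivative:
  fixes k :: "real \<Rightarrow> real"
  assumes k: "continuous_on UNIV k" "integrable lborel k"
  shows "((\<lambda>x. LINT t:{..x}|lborel. k t) has_real_derivative k x) (at x)"
proof -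
  have si: "set_integrable lborel A k" if "A \<in> sets borel" for A
    using that assms by (intro set_integrable_borel) auto
  have split: "(LINT t:{..y}|lborel. k t) = (LINT t:{..x-1}|lborel. k t) + (LBINT t=x-1..y. k t)"
    if "x - 1 < y" for y
  proof -
    have "(LINT t:{..y}|lborel. k t) = (LINT t:{..x-1} \<union> {x-1<..y}|lborel. k t)"
      using that by (intro arg_cong2[where f="\<lambda>A. set_lebesgue_integral lborel A"]) auto
    also have "\<dots> = (LINT t:{..x-1}|lborel. k t) + (LINT t:{x-1<..y}|lborel. k t)"
      by (intro set_integral_Un si) auto
    also have "(LINT t:{x-1<..y}|lborel. k t) = (LBINT t=x-1..y. k t)"
      using that by (simp add: interval_integral_Ioc)
    finally show ?thesis .
  qed
  have "((\<lambda>u. LBINT t=x-1..u. k t) has_vector_derivative k x) (at x within {x-1..x+1})"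
    by (rule interval_integral_FTC2) (auto intro: continuous_on_subset[OF k(1)])
  then have "((\<lambda>u. LBINT t=x-1..u. k t) has_real_derivative k x) (at x within {x-1..x+1})"
    by (simp add: has_real_derivative_iff_has_vector_derivative)
  then have "((\<lambda>u. LBINT t=x-1..u. k t) has_real_derivative k x) (at x)"
    by (subst (asm) at_within_interior) auto
  then have "((\<lambda>u. (LINT t:{..x-1}|lborel. k t) + (LBINT t=x-1..u. k t)) has_real_derivative k x) (at x)"
    by (auto intro!: derivative_eq_intros)
  moreover have "eventually (\<lambda>u. (LINT t:{..x-1}|lborel. k t) + (LBINT t=x-1..u. k t)
      = (LINT t:{..u}|lborel. k t)) (nhds x)"
    using eventually_nhds_in_open[of "{x-1<..}" x] split by (auto elim!: eventually_mono)
  ultimately show ?thesis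
    by (subst (asm) DERIV_cong_ev[OF refl _ refl])
qed

abbreviation (input) "phi \<equiv> std_normal_density"

lemma std_normal_density_deriv:
  "(phi has_real_derivative - t * phi t) (at t)"
  unfolding std_normal_density_def
  by (auto intro!: derivative_eq_intros simp: field_simps)

lemma continuous_on_std_normal_density: "continuous_on A phi"
  unfolding std_normal_density_def by (intro continuous_intros) auto

lemma integrable_std_normal_mult:
  assumes k: "k \<in> borel_measurable borel" and le: "\<And>t. \<bar>k t\<bar> \<le> C + D * \<bar>t\<bar> + E * t\<^sup>2"
  shows "integrable lborel (\<lambda>t. phi t * k t)"
proof (rule Bochner_Integration.integrable_bound)
  show "integrable lborel (\<lambda>t. C * phi t + D * (phi t * \<bar>t\<bar>^1) + E * (phi t * \<bar>t\<bar>^2))"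
    by (intro Bochner_Integration.integrable_add integrable_mult_right
        integrable_std_normal_moment_abs integrable_normal_density zero_less_one)
  have "\<bar>phi t * k t\<bar> \<le> C * phi t + D * (phi t * \<bar>t\<bar>^1) + E * (phi t * \<bar>t\<bar>^2)" for t
    using mult_left_mono[OF le[of t], of "phi t"] by (simp add: abs_mult algebra_simps)
  then show "AE t in lborel. norm (phi t * k t) \<le> norm (C * phi t + D * (phi t * \<bar>t\<bar>^1) + E * (phi t * \<bar>t\<bar>^2))"
    by (intro AE_I2) (smt (verit) real_norm_def)
qed (use k in measurable)

definition upper_tail :: "real \<Rightarrow> real" where
  "upper_tail x = (LINT t:{x<..}|lborel. phi t)"

lemma set_integral_split_at:
  fixes k :: "real \<Rightarrow> real"
  assumes "integrable lborel k"
  shows "(LINT t:{..x}|lborel. k t) = (LINT t|lborel. k t) - (LINT t:{x<..}|lborel. k t)"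
proof -
  have si: "set_integrable lborel A k" if "A \<in> sets borel" for A
    using that assms by (intro set_integrable_borel) auto
  have UNIV: "{..x} \<union> {x<..} = UNIV" by auto
  have "(LINT t|lborel. k t) = (LINT t:{..x} \<union> {x<..}|lborel. k t)"
    using UNIV by (simp add: set_lebesgue_integral_def)
  also have "\<dots> = (LINT t:{..x}|lborel. k t) + (LINT t:{x<..}|lborel. k t)"
    by (intro set_integral_Un si) auto
  finally show ?thesis by simp
qed

lemma std_normal_upper_moment_1: "(LINT t:{x<..}|lborel. phi t * t) = phi x"
proof -
  have "(LINT t:{x<..}|lborel. phi t * t) = - (- phi x)"
  proof (rule set_integral_greaterThan_FTC)
    show "((\<lambda>x. - phi x) has_real_derivative phi t * t) (at t)" for t
      by (auto intro!: derivative_eq_intros std_normal_density_deriv)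
    show "integrable lborel (\<lambda>t. phi t * t)"
      by (rule integrable_std_normal_mult[where C=0 and D=1 and E=0]) auto
    show "((\<lambda>x. - phi x) \<longlongrightarrow> 0) at_top"
      unfolding std_normal_density_def by real_asymp
  qed (intro continuous_intros continuous_on_std_normal_density)
  then show ?thesis by simp
qed

lemma std_normal_upper_moment_2:
  "(LINT t:{x<..}|lborel. phi t * t\<^sup>2) = x * phi x + upper_tail x"
proof -
  have int: "integrable lborel (\<lambda>t. phi t * t\<^sup>2)"
    by (rule integrable_std_normal_mult[where C=0 and D=0 and E=1]) auto
  have "(LINT t:{x<..}|lborel. phi t * t\<^sup>2 - phi t) = - (- x * phi x)"
  proof (rule set_integral_greaterThan_FTC)
    show "((\<lambda>x. - x * phi x) has_real_derivative phi t * t\<^sup>2 - phi t) (at t)" for t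
      by (auto intro!: derivative_eq_intros std_normal_density_deriv simp: power2_eq_square)
    show "((\<lambda>x. - x * phi x) \<longlongrightarrow> 0) at_top"
      unfolding std_normal_density_def by real_asymp
  qed (intro continuous_intros continuous_on_std_normal_density Bochner_Integration.integrable_diff int
      integrable_normal_density zero_less_one)+
  moreover have "(LINT t:{x<..}|lborel. phi t * t\<^sup>2 - phi t)
    = (LINT t:{x<..}|lborel. phi t * t\<^sup>2) - (LINT t:{x<..}|lborel. phi t)"
    by (intro set_integral_diff set_integrable_borel int integrable_normal_density zero_less_one) auto
  ultimately show ?thesis by (simp add: upper_tail_def)
qed

text \<open>These bounds for the tails, a form of Mills' ratio inequality, hold because both expressions
  are integrals of \<open>(t - x)\<^sup>2 * phi t\<close> over a half line.\<close>

lemma stein_coefficient_nonneg: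
  "(1 + x\<^sup>2) * upper_tail x - x * phi x \<ge> 0"
  "(1 + x\<^sup>2) * (1 - upper_tail x) + x * phi x \<ge> 0"
proof -
  have i: "integrable lborel (\<lambda>t. phi t * t\<^sup>2)" "integrable lborel (\<lambda>t. phi t * t)"
    by (rule integrable_std_normal_mult[where C=0 and D=0 and E=1], auto)
      (rule integrable_std_normal_mult[where C=0 and D=1 and E=0], auto)
  have j: "integrable lborel phi" by simp
  note si = set_integrable_borel
  have exp: "(LINT t:A|lborel. (t - x)\<^sup>2 * phi t)
      = (LINT t:A|lborel. phi t * t\<^sup>2) - 2 * x * (LINT t:A|lborel. phi t * t)
        + x\<^sup>2 * (LINT t:A|lborel. phi t)" if "A \<in> sets borel" for A
  proof -
    have "(LINT t:A|lborel. (t - x)\<^sup>2 * phi t)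
       = (LINT t:A|lborel. phi t * t\<^sup>2 - 2 * x * (phi t * t) + x\<^sup>2 * phi t)"
      by (simp add: power2_eq_square algebra_simps)
    also have "\<dots> = (LINT t:A|lborel. phi t * t\<^sup>2) - (LINT t:A|lborel. 2 * x * (phi t * t))
        + (LINT t:A|lborel. x\<^sup>2 * phi t)"
      using si[OF i(1) that] si[OF i(2) that] si[OF j that]
      by (simp add: set_integral_add set_integral_diff)
    finally show ?thesis by simp
  qed
  have nn: "0 \<le> (LINT t:A|lborel. (t - x)\<^sup>2 * phi t)" for A
    unfolding set_lebesgue_integral_def by (intro Bochner_Integration.integral_nonneg) auto
  show "(1 + x\<^sup>2) * upper_tail x - x * phi x \<ge> 0"
    using nn[of "{x<..}"] std_normal_upper_moment_1[of x] std_normal_upper_moment_2[of x]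
    by (subst (asm) exp) (auto simp: upper_tail_def algebra_simps power2_eq_square)
  have tot: "(LINT t|lborel. phi t * t\<^sup>2) = 1" "(LINT t|lborel. phi t * t) = 0"
    using integral_std_normal_moment_even[of 1] integral_std_normal_moment_odd[of 0]
    by auto
  show "(1 + x\<^sup>2) * (1 - upper_tail x) + x * phi x \<ge> 0"
    using nn[of "{..x}"]
    by (subst (asm) exp)
      (simp_all add: set_integral_split_at[OF i(1)] set_integral_split_at[OF i(2)]
         set_integral_split_at[OF j] std_normal_upper_moment_1 std_normal_upper_moment_2 tot
         flip: upper_tail_def, simp add: algebra_simps power2_eq_square)
qed

text \<open>The solution is \<open>f x = F x / phi x\<close> where \<open>F x\<close> is the integral of \<open>(h - E h) * phi\<close> over
  \<open>{..x}\<close>. As \<open>f' x = x * f x + (h x - E h)\<close>, the Lipschitz bound for \<open>f'\<close> follows from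
  \<open>|k x| \<le> L\<close> for the derivative \<open>k x = f x + x * f' x\<close> of \<open>x * f x\<close>. Expressing \<open>h\<close> through \<open>h - h x\<close> turns
  \<open>phi x * k x\<close> into \<open>P * A - Q * B\<close>, where \<open>P\<close>, \<open>Q\<close> are the integrals of \<open>(h - h x) * phi\<close> over
  the half lines below and above \<open>x\<close> and \<open>A\<close>, \<open>B\<close> are the nonnegative quantities of
  \<open>stein_coefficient_nonneg\<close>. The Lipschitz condition bounds \<open>|P|\<close> and \<open>|Q|\<close> by their values for
  \<open>h t = L * |t - x|\<close>, for which \<open>|P| * A + |Q| * B\<close> equals \<open>L * phi x\<close>.\<close>

lemma stein_solution:
  fixes h :: "real \<Rightarrow> real"
  assumes lip: "\<And>x y. \<bar>h y - h x\<bar> \<le> L * \<bar>y - x\<bar>"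
  obtains f f' where "\<And>x. (f has_real_derivative f' x) (at x)"
    and "\<And>x. f' x - x * f x = h x - (\<integral>z. h z \<partial>std_normal_distribution)"
    and "\<And>x y. \<bar>f' y - f' x\<bar> \<le> 2 * L * \<bar>y - x\<bar>"
    and "\<And>x. \<bar>f x\<bar> \<le> L"
proof -
  have L: "0 \<le> L" using lip[of 1 0] by simp
  have lipc: "L-lipschitz_on UNIV h"
    using lip L by (intro lipschitz_onI) (auto simp: dist_real_def abs_minus_commute)
  then have conth: "continuous_on UNIV h" by (rule lipschitz_on_continuous_on)
  then have hm[measurable]: "h \<in> borel_measurable borel" by (rule borel_measurable_continuous_onI)
  have ih: "integrable lborel (\<lambda>t. phi t * h t)"
  proof (rule integrable_std_normal_mult[where C="\<bar>h 0\<bar>" and D=L and E=0])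
    show "\<bar>h t\<bar> \<le> \<bar>h 0\<bar> + L * \<bar>t\<bar> + 0 * t\<^sup>2" for t
      using lip[of t 0] by simp
  qed simp
  have i1: "integrable lborel (\<lambda>t. phi t * t)"
    by (rule integrable_std_normal_mult[where C=0 and D=1 and E=0]) auto
  have j: "integrable lborel phi" by simp
  define m where "m = (\<integral>z. h z \<partial>std_normal_distribution)"
  have m: "m = (LINT t|lborel. phi t * h t)"
    unfolding m_def by (subst integral_density) auto
  have tot: "(LINT t|lborel. phi t * t) = 0"
    using integral_std_normal_moment_odd[of 0] by auto
  define F where "F x = (LINT t:{..x}|lborel. phi t * h t - m * phi t)" for x
  define f where "f x = F x / phi x" for x
  define f' where "f' x = h x - m + x * f x" for x
  have pos: "phi x > 0" for x by (simp add: normal_density_pos)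
  have F: "(F has_real_derivative phi x * h x - m * phi x) (at x)" for x
    unfolding F_def
    by (rule set_integral_atMost_has_derivative)
      (intro continuous_intros conth continuous_on_std_normal_density Bochner_Integration.integrable_diff
         ih integrable_mult_right j)+
  have df: "(f has_real_derivative f' x) (at x)" for x
    unfolding f_def f'_def
    using pos[of x]
    by (auto intro!: derivative_eq_intros F std_normal_density_deriv
        simp: field_simps power2_eq_square)
  define k where "k x = f x + x * f' x" for x
  have dk: "((\<lambda>x. x * f x) has_real_derivative k x) (at x)" for x
    unfolding k_def by (auto intro!: derivative_eq_intros df)
  have kL: "\<bar>k x\<bar> \<le> L" for x
  proof -
    note si = set_integrable_borel
    define H where "H A = (LINT t:A|lborel. phi t * h t - h x * phi t)" for A
    define D where "D A = (LINT t:A|lborel. phi t * t - x * phi t)" for A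
    have iH: "integrable lborel (\<lambda>t. phi t * h t - h x * phi t)"
      and iD: "integrable lborel (\<lambda>t. phi t * t - x * phi t)"
      and iF: "integrable lborel (\<lambda>t. phi t * h t - m * phi t)"
      by (intro Bochner_Integration.integrable_diff ih integrable_mult_right j i1)+
    have HP: "\<bar>H A\<bar> \<le> L * \<bar>D A\<bar>"
      if A: "A \<in> sets borel" and s: "(\<forall>t\<in>A. t \<le> x) \<or> (\<forall>t\<in>A. t \<ge> x)" for A
    proof -
      have "\<bar>H A\<bar> \<le> (LINT t:A|lborel. \<bar>phi t * h t - h x * phi t\<bar>)"
        unfolding H_def set_lebesgue_integral_def
        by (rule order_trans[OF integral_abs_bound]) (simp add: abs_mult)
      also have "\<dots> \<le> (LINT t:A|lborel. L * \<bar>phi t * t - x * phi t\<bar>)"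
      proof (rule set_integral_mono)
        fix t
        have "\<bar>phi t * h t - h x * phi t\<bar> = phi t * \<bar>h t - h x\<bar>"
          using pos[of t] by (simp add: abs_mult flip: left_diff_distrib right_diff_distrib mult.commute[of "phi t"])
        also have "\<dots> \<le> phi t * (L * \<bar>t - x\<bar>)"
          using lip[of t x] pos[of t] by (intro mult_left_mono) auto
        also have "\<dots> = L * \<bar>phi t * t - x * phi t\<bar>"
          using pos[of t] by (simp add: abs_mult flip: left_diff_distrib right_diff_distrib mult.commute[of "phi t"])
        finally show "\<bar>phi t * h t - h x * phi t\<bar> \<le> L * \<bar>phi t * t - x * phi t\<bar>" .
      qed (intro si A integrable_abs iH iD integrable_mult_right)+
      also have "\<dots> = L * \<bar>D A\<bar>"
      proof -
        have "(LINT t:A|lborel. \<bar>phi t * t - x * phi t\<bar>) = \<bar>D A\<bar>"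
        proof (cases "\<forall>t\<in>A. t \<ge> x")
          case True
          then have *: "(LINT t:A|lborel. \<bar>phi t * t - x * phi t\<bar>) = D A"
            unfolding D_def using A pos
            by (intro set_lebesgue_integral_cong) (auto simp: abs_if mult.commute[of "phi _"] less_imp_le)
          have "D A = (LINT t:A|lborel. \<bar>phi t * t - x * phi t\<bar>)" using * by simp
          also have "\<dots> \<ge> 0" unfolding set_lebesgue_integral_def
            by (intro Bochner_Integration.integral_nonneg) auto
          finally show ?thesis using * by simp
        next
          case False
          then have "(LINT t:A|lborel. \<bar>phi t * t - x * phi t\<bar>) = (LINT t:A|lborel. - (phi t * t - x * phi t))"
            using A pos s
            by (intro set_lebesgue_integral_cong) (auto simp: abs_if mult.commute[of "phi _"] less_imp_le)
          then have *: "(LINT t:A|lborel. \<bar>phi t * t - x * phi t\<bar>) = - D A"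
            using set_integral_uminus[OF si[OF iD A]] by (simp add: D_def)
          have "- D A = (LINT t:A|lborel. \<bar>phi t * t - x * phi t\<bar>)" using * by simp
          also have "\<dots> \<ge> 0" unfolding set_lebesgue_integral_def
            by (intro Bochner_Integration.integral_nonneg) auto
          finally show ?thesis using * by simp
        qed
        then show ?thesis by simp
      qed
      finally show ?thesis .
    qed
    define c where "c = upper_tail x"
    have c1: "(LINT t:{..x}|lborel. phi t) = 1 - c"
      unfolding c_def upper_tail_def by (simp add: set_integral_split_at[OF j])
    have Du: "D {x<..} = phi x - x * c"
      using si[OF i1, of "{x<..}"] si[OF j, of "{x<..}"] std_normal_upper_moment_1[of x]
      unfolding D_def c_def upper_tail_def by (subst set_integral_diff) auto
    have Dl: "D {..x} = - (phi x + x * (1 - c))"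
      using si[OF i1, of "{..x}"] si[OF j, of "{..x}"] std_normal_upper_moment_1[of x] tot
      unfolding D_def by (subst set_integral_diff) (auto simp: c1 set_integral_split_at[OF i1])
    define P where "P = H {..x}"
    define Q where "Q = H {x<..}"
    have "Q = (LINT t|lborel. phi t * h t - h x * phi t) - P"
      unfolding P_def Q_def H_def by (simp add: set_integral_split_at[OF iH])
    then have mPQ: "m = P + Q + h x" using ih j by (simp add: m)
    have Fx: "F x = P + (h x - m) * (1 - c)"
      using si[OF ih, of "{..x}"] si[OF j, of "{..x}"]
      unfolding F_def P_def H_def by (simp add: set_integral_diff c1 algebra_simps)
    define A where "A = (1 + x\<^sup>2) * c - x * phi x"
    define B where "B = (1 + x\<^sup>2) * (1 - c) + x * phi x"
    have AB: "A \<ge> 0" "B \<ge> 0" using stein_coefficient_nonneg[of x] by (auto simp: A_def B_def c_def)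
    have "phi x * k x = (1 + x\<^sup>2) * F x + x * (h x - m) * phi x"
      using pos[of x] unfolding k_def f'_def f_def by (simp add: field_simps power2_eq_square)
    also have "\<dots> = P * A - Q * B"
      unfolding Fx mPQ A_def B_def by (simp add: algebra_simps power2_eq_square)
    finally have "phi x * \<bar>k x\<bar> = \<bar>P * A - Q * B\<bar>"
      using pos[of x] by (metis abs_mult abs_of_pos)
    also have "\<dots> \<le> \<bar>P\<bar> * A + \<bar>Q\<bar> * B"
      using AB abs_triangle_ineq4[of "P * A" "Q * B"] by (simp add: abs_mult)
    also have "\<dots> \<le> (L * \<bar>D {..x}\<bar>) * A + (L * \<bar>D {x<..}\<bar>) * B"
      using AB HP[of "{..x}"] HP[of "{x<..}"] unfolding P_def Q_def
      by (intro add_mono mult_right_mono) auto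
    also have "\<bar>D {x<..}\<bar> = D {x<..}"
      unfolding D_def set_lebesgue_integral_def
      by (intro abs_of_nonneg Bochner_Integration.integral_nonneg)
        (use pos in \<open>auto simp: indicator_def mult.commute[of "phi _"] less_imp_le\<close>)
    also have "\<bar>D {..x}\<bar> = - D {..x}"
    proof -
      have "0 \<le> (LINT t:{..x}|lborel. - (phi t * t - x * phi t))"
        unfolding set_lebesgue_integral_def
        by (intro Bochner_Integration.integral_nonneg)
          (use pos in \<open>auto simp: indicator_def mult.commute[of "phi _"] less_imp_le\<close>)
      then show ?thesis using set_integral_uminus[OF si[OF iD, of "{..x}"]] by (simp add: D_def)
    qed
    also have "L * - D {..x} * A + L * D {x<..} * B = L * phi x"
      unfolding Dl Du A_def B_def by (simp add: algebra_simps power2_eq_square)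
    finally show ?thesis using pos[of x] by (simp add: mult.commute)
  qed
  have xf: "\<bar>y * f y - x * f x\<bar> \<le> L * \<bar>y - x\<bar>" for x y
    using field_differentiable_bound[of UNIV "\<lambda>x. x * f x" k L y x] dk kL by auto
  show thesis
  proof (rule that[of f f'])
    show "\<bar>f' y - f' x\<bar> \<le> 2 * L * \<bar>y - x\<bar>" for x y
      using xf[of y x] lip[of y x] unfolding f'_def by (simp add: algebra_simps)
    \<comment> \<open>\<open>x * f x\<close> is \<open>L\<close>-Lipschitz and vanishes at 0; at \<open>x = 0\<close> itself, \<open>f 0 = k 0\<close>.\<close>
    show "\<bar>f x\<bar> \<le> L" for x
    proof (cases "x = 0")
      case True
      then show ?thesis using kL[of 0] by (simp add: k_def)
    next
      case False
      then show ?thesis using xf[of x 0] by (simp add: abs_mult mult.commute[of _ "\<bar>x\<bar>"])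
    qed
  qed (use df in \<open>simp_all add: f'_def m_def\<close>)
qed

section \<open>Normal approximation of standardised sums\<close>

text \<open>The constant \<open>L\<close>, half of the Lipschitz constant of the derivative, comes from the
  monotonicity of \<open>L * s\<^sup>2\<close> minus or plus the remainder in \<open>s\<close>; the mean value theorem would only
  give \<open>2 * L\<close>.\<close>

lemma taylor_lipschitz_deriv_pos:
  fixes f f' :: "real \<Rightarrow> real"
  assumes f: "\<And>x. (f has_real_derivative f' x) (at x)"
    and lip: "\<And>x y. \<bar>f' y - f' x\<bar> \<le> 2 * L * \<bar>y - x\<bar>"
    and y: "y \<ge> 0"
  shows "\<bar>f (t + y) - f t - y * f' t\<bar> \<le> L * y\<^sup>2"
proof -
  have f'[derivative_intros]: "((\<lambda>s. f (t + s)) has_real_derivative f' (t + s)) (at s)" for s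
    using DERIV_shift[of f "f' (t + s)" s t] f[of "t + s"] by (simp add: add.commute)
  have *: "0 \<le> L * y\<^sup>2 - c * (f (t + y) - f t - y * f' t)" if c: "c = 1 \<or> c = -1" for c
  proof -
    have "L * 0\<^sup>2 - c * (f (t + 0) - f t - 0 * f' t) \<le> L * y\<^sup>2 - c * (f (t + y) - f t - y * f' t)"
    proof (rule DERIV_nonneg_imp_nondecreasing[OF y])
      fix s :: real assume s: "0 \<le> s" "s \<le> y"
      have "((\<lambda>y. L * y\<^sup>2 - c * (f (t + y) - f t - y * f' t)) has_real_derivative
          2 * L * s - c * (f' (t + s) - f' t)) (at s)"
        by (auto intro!: derivative_eq_intros)
      moreover have "0 \<le> 2 * L * s - c * (f' (t + s) - f' t)"
        using lip[of "t + s" t] s c by auto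
      ultimately show "\<exists>d. ((\<lambda>y. L * y\<^sup>2 - c * (f (t + y) - f t - y * f' t)) has_real_derivative d) (at s) \<and> 0 \<le> d"
        by blast
    qed
    then show ?thesis by simp
  qed
  show ?thesis using *[of 1] *[of "-1"] by simp
qed

lemma taylor_lipschitz_deriv:
  fixes f f' :: "real \<Rightarrow> real"
  assumes f: "\<And>x. (f has_real_derivative f' x) (at x)"
    and lip: "\<And>x y. \<bar>f' y - f' x\<bar> \<le> 2 * L * \<bar>y - x\<bar>"
  shows "\<bar>f (t + y) - f t - y * f' t\<bar> \<le> L * y\<^sup>2"
proof (cases "y \<ge> 0")
  case True
  then show ?thesis by (intro taylor_lipschitz_deriv_pos f lip)
next
  case False
  have "\<bar>f (- (- t + - y)) - f (- (- t)) - (- y) * (- f' (- (- t)))\<bar> \<le> L * (- y)\<^sup>2"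
  proof (rule taylor_lipschitz_deriv_pos[of "\<lambda>x. f (- x)" "\<lambda>x. - f' (- x)" L "- y" "- t"])
    show "((\<lambda>x. f (- x)) has_real_derivative - f' (- x)) (at x)" for x
      using DERIV_mirror[of f "f' (- x)" x] f[of "- x"] by simp
    show "\<bar>- f' (- y) - - f' (- x)\<bar> \<le> 2 * L * \<bar>y - x\<bar>" for x y
      using lip[of "- x" "- y"] by (simp add: abs_minus_commute)
  qed (use False in auto)
  then show ?thesis by (simp add: add.commute)
qed

lemma abs_integral_le:
  fixes f g :: "'a \<Rightarrow> real"
  assumes "integrable M f" "integrable M g" "\<And>x. \<bar>f x\<bar> \<le> g x"
  shows "\<bar>\<integral>x. f x \<partial>M\<bar> \<le> (\<integral>x. g x \<partial>M)"
  by (rule order_trans[OF integral_abs_bound])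
    (use assms in \<open>auto intro!: integral_mono\<close>)

context prob_space
begin

text \<open>For the normalised sum \<open>W\<close> and the solution \<open>f\<close> of the Stein equation, the quantity to be
  bounded is \<open>E f' W - E (W * f W)\<close>. Each summand \<open>Y i\<close> is independent of the sum \<open>T\<close> of the others.
  Expanding \<open>f W\<close> around \<open>T\<close> in \<open>E (Y i * f W)\<close>, the constant term vanishes, the linear term gives
  \<open>E f' T / sqrt n\<close>, and the remainder gives the third moment; replacing \<open>T\<close> by \<open>W\<close> in \<open>f'\<close> costs
  \<open>2 L / sqrt n\<close>.\<close>

lemma stein_bound_iid:
  fixes Y :: "nat \<Rightarrow> 'a \<Rightarrow> real" and h :: "real \<Rightarrow> real"
  assumes ind: "indep_vars (\<lambda>_. borel) Y UNIV"
    and idd: "\<And>i. distr M borel (Y i) = distr M borel (Y 0)"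
    and int3: "integrable M (\<lambda>\<omega>. \<bar>Y 0 \<omega>\<bar> ^ 3)"
    and mean: "expectation (Y 0) = 0" and var: "expectation (\<lambda>\<omega>. (Y 0 \<omega>)\<^sup>2) = 1"
    and lip: "\<And>x y. \<bar>h y - h x\<bar> \<le> L * \<bar>y - x\<bar>"
    and n: "n \<ge> 1"
  shows "\<bar>expectation (\<lambda>\<omega>. h ((\<Sum>i<n. Y i \<omega>) / sqrt n)) - (\<integral>z. h z \<partial>std_normal_distribution)\<bar>
      \<le> L / sqrt n * (2 + expectation (\<lambda>\<omega>. \<bar>Y 0 \<omega>\<bar> ^ 3))"
proof -
  obtain f f' where f: "\<And>x. (f has_real_derivative f' x) (at x)"
    and stein: "\<And>x. f' x - x * f x = h x - (\<integral>z. h z \<partial>std_normal_distribution)"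
    and lf: "\<And>x y. \<bar>f' y - f' x\<bar> \<le> 2 * L * \<bar>y - x\<bar>"
    and bf: "\<And>x. \<bar>f x\<bar> \<le> L"
    using stein_solution[of h L] lip by blast
  have L: "0 \<le> L" using lip[of 1 0] by simp
  define r where "r = sqrt (real n)"
  have r: "r > 0" "r * r = real n" using n by (auto simp: r_def)
  define \<beta> where "\<beta> = expectation (\<lambda>\<omega>. \<bar>Y 0 \<omega>\<bar> ^ 3)"
  have Ym[measurable]: "random_variable borel (Y i)" for i
    using ind by (auto simp: indep_vars_def)
  have fm[measurable]: "f \<in> borel_measurable borel"
    using f by (intro borel_measurable_continuous_onI) (meson DERIV_continuous_on DERIV_subset subset_UNIV)
  have "(2 * L)-lipschitz_on UNIV f'"
    using lf L by (intro lipschitz_onI) (auto simp: dist_real_def abs_minus_commute)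
  then have f'm[measurable]: "f' \<in> borel_measurable borel"
    by (intro borel_measurable_continuous_onI lipschitz_on_continuous_on)
  have f'b: "\<bar>f' x\<bar> \<le> \<bar>f' 0\<bar> + 2 * L * \<bar>x\<bar>" for x using lf[of x 0] by simp
  have EY: "expectation (\<lambda>\<omega>. k (Y i \<omega>)) = expectation (\<lambda>\<omega>. k (Y 0 \<omega>))"
    and IY: "integrable M (\<lambda>\<omega>. k (Y i \<omega>)) \<longleftrightarrow> integrable M (\<lambda>\<omega>. k (Y 0 \<omega>))"
    if "k \<in> borel_measurable borel" for k :: "real \<Rightarrow> real" and i
    using integral_distr[of "Y i" M borel k] integral_distr[of "Y 0" M borel k]
      integrable_distr_eq[of "Y i" M borel k] integrable_distr_eq[of "Y 0" M borel k] idd[of i] that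
    by auto
  have i3: "integrable M (\<lambda>\<omega>. \<bar>Y i \<omega>\<bar> ^ 3)" for i
    using IY[of "\<lambda>y. \<bar>y\<bar> ^ 3" i] int3 by simp
  have le3: "\<bar>y\<bar> \<le> 1 + \<bar>y\<bar> ^ 3" "y\<^sup>2 \<le> 1 + \<bar>y\<bar> ^ 3" for y :: real
  proof -
    have "\<bar>y\<bar> \<le> 1 + \<bar>y\<bar> ^ 3 \<and> y\<^sup>2 \<le> 1 + \<bar>y\<bar> ^ 3"
    proof (cases "\<bar>y\<bar> \<ge> 1")
      case True
      have "\<bar>y\<bar> ^ 1 \<le> \<bar>y\<bar> ^ 3" "\<bar>y\<bar> ^ 2 \<le> \<bar>y\<bar> ^ 3"
        by (rule power_increasing; use True in simp)+
      then show ?thesis by simp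
    next
      case False
      have "\<bar>y\<bar> ^ 2 \<le> 1" by (rule power_le_one) (use False in auto)
      moreover have "0 \<le> \<bar>y\<bar> ^ 3" by simp
      ultimately show ?thesis using False unfolding power2_abs by linarith
    qed
    then show "\<bar>y\<bar> \<le> 1 + \<bar>y\<bar> ^ 3" "y\<^sup>2 \<le> 1 + \<bar>y\<bar> ^ 3" by blast+
  qed
  have i1: "integrable M (Y i)" for i
    by (rule Bochner_Integration.integrable_bound[OF Bochner_Integration.integrable_add[OF integrable_const[of 1] i3[of i]]])
      (use order_trans[OF le3(1) abs_ge_self] in \<open>simp_all add: AE_I2\<close>)
  have i2: "integrable M (\<lambda>\<omega>. (Y i \<omega>)\<^sup>2)" for i
    by (rule Bochner_Integration.integrable_bound[OF Bochner_Integration.integrable_add[OF integrable_const[of 1] i3[of i]]])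
      (use order_trans[OF le3(2) abs_ge_self] in \<open>simp_all add: AE_I2\<close>)
  have mean_i: "expectation (Y i) = 0" for i using EY[of "\<lambda>y. y" i] mean by simp
  have var_i: "expectation (\<lambda>\<omega>. (Y i \<omega>)\<^sup>2) = 1" for i using EY[of "\<lambda>y. y\<^sup>2" i] var by simp
  have abs_i: "expectation (\<lambda>\<omega>. \<bar>Y i \<omega>\<bar>) \<le> 1" for i
  proof -
    have "expectation (\<lambda>\<omega>. \<bar>Y i \<omega>\<bar>) \<le> expectation (\<lambda>\<omega>. (1 + (Y i \<omega>)\<^sup>2) / 2)"
    proof (rule integral_mono)
      show "\<bar>Y i \<omega>\<bar> \<le> (1 + (Y i \<omega>)\<^sup>2) / 2" for \<omega>
        using zero_le_power2[of "\<bar>Y i \<omega>\<bar> - 1"] by (simp add: power2_diff)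
    qed (use i1 i2 in auto)
    also have "\<dots> = 1" using i2[of i] by (simp add: var_i prob_space)
    finally show ?thesis .
  qed
  define W where "W \<omega> = (\<Sum>i<n. Y i \<omega>) / r" for \<omega>
  have Wm[measurable]: "random_variable borel W" unfolding W_def by measurable
  have iW: "integrable M W" unfolding W_def using i1 by auto
  have if': "integrable M (\<lambda>\<omega>. f' (V \<omega>))" if V: "integrable M V" for V
  proof (rule Bochner_Integration.integrable_bound)
    show "integrable M (\<lambda>\<omega>. \<bar>f' 0\<bar> + 2 * L * \<bar>V \<omega>\<bar>)" using V by auto
    show "(\<lambda>\<omega>. f' (V \<omega>)) \<in> borel_measurable M" using V by measurable
    show "AE \<omega> in M. norm (f' (V \<omega>)) \<le> norm (\<bar>f' 0\<bar> + 2 * L * \<bar>V \<omega>\<bar>)"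
      using order_trans[OF f'b abs_ge_self] by (simp add: AE_I2)
  qed
  have ifb: "integrable M (\<lambda>\<omega>. f (V \<omega>))" if V: "V \<in> borel_measurable M" for V
    using V bf by (intro integrable_const_bound[of _ L]) auto
  have iYf: "integrable M (\<lambda>\<omega>. Y i \<omega> * f (V \<omega>))" if V: "V \<in> borel_measurable M" for i V
  proof (rule Bochner_Integration.integrable_bound)
    show "integrable M (\<lambda>\<omega>. L * Y i \<omega>)" using i1 by auto
    show "AE \<omega> in M. norm (Y i \<omega> * f (V \<omega>)) \<le> norm (L * Y i \<omega>)"
      using L bf by (intro AE_I2)
        (simp add: abs_mult mult.commute[of L] mult_left_mono)
  qed (use V in measurable)
  have key: "\<bar>expectation (\<lambda>\<omega>. f' (W \<omega>)) - r * expectation (\<lambda>\<omega>. Y i \<omega> * f (W \<omega>))\<bar> \<le> L / r * (2 + \<beta>)"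
    if i: "i < n" for i
  proof -
    define T where "T \<omega> = (\<Sum>j\<in>{..<n} - {i}. Y j \<omega>) / r" for \<omega>
    have Tm[measurable]: "random_variable borel T" unfolding T_def by measurable
    have iT: "integrable M T" unfolding T_def using i1 by auto
    have WT: "W \<omega> = T \<omega> + Y i \<omega> / r" for \<omega>
      using i by (simp add: W_def T_def sum.remove[of "{..<n}" i] add_divide_distrib)
    have indY: "indep_var borel (Y i) borel (\<lambda>\<omega>. \<Sum>j\<in>{..<n} - {i}. Y j \<omega>)"
      by (rule indep_vars_sum) (auto intro: indep_vars_subset[OF ind])
    have ind1: "indep_var borel (Y i) borel (\<lambda>\<omega>. f (T \<omega>))"
      using indep_var_compose[OF indY, of "\<lambda>x. x" borel "\<lambda>s. f (s / r)" borel]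
      by (simp add: T_def comp_def)
    have ind2: "indep_var borel (\<lambda>\<omega>. (Y i \<omega>)\<^sup>2) borel (\<lambda>\<omega>. f' (T \<omega>))"
      using indep_var_compose[OF indY, of "\<lambda>x. x\<^sup>2" borel "\<lambda>s. f' (s / r)" borel]
      by (simp add: T_def comp_def)
    have e1: "expectation (\<lambda>\<omega>. Y i \<omega> * f (T \<omega>)) = 0"
      using indep_var_lebesgue_integral[OF ind1 i1 ifb[OF Tm]] mean_i by simp
    have e2: "expectation (\<lambda>\<omega>. (Y i \<omega>)\<^sup>2 * f' (T \<omega>)) = expectation (\<lambda>\<omega>. f' (T \<omega>))"
      using indep_var_lebesgue_integral[OF ind2 i2 if'[OF iT]] var_i by simp
    have j2: "integrable M (\<lambda>\<omega>. (Y i \<omega>)\<^sup>2 * f' (T \<omega>))"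
      by (rule indep_var_integrable[OF ind2 i2 if'[OF iT]])
    have eq: "expectation (\<lambda>\<omega>. Y i \<omega> * (f (W \<omega>) - f (T \<omega>) - Y i \<omega> / r * f' (T \<omega>)))
        = expectation (\<lambda>\<omega>. Y i \<omega> * f (W \<omega>)) - expectation (\<lambda>\<omega>. f' (T \<omega>)) / r"
    proof -
      have "expectation (\<lambda>\<omega>. Y i \<omega> * (f (W \<omega>) - f (T \<omega>) - Y i \<omega> / r * f' (T \<omega>)))
         = expectation (\<lambda>\<omega>. Y i \<omega> * f (W \<omega>) - Y i \<omega> * f (T \<omega>) - (Y i \<omega>)\<^sup>2 * f' (T \<omega>) / r)"
        by (simp add: algebra_simps power2_eq_square)
      also have "\<dots> = expectation (\<lambda>\<omega>. Y i \<omega> * f (W \<omega>)) - expectation (\<lambda>\<omega>. Y i \<omega> * f (T \<omega>))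
          - expectation (\<lambda>\<omega>. (Y i \<omega>)\<^sup>2 * f' (T \<omega>)) / r"
        using iYf[OF Wm, of i] iYf[OF Tm, of i] j2 by simp
      finally show ?thesis by (simp add: e1 e2)
    qed
    have rem: "\<bar>Y i \<omega> * (f (W \<omega>) - f (T \<omega>) - Y i \<omega> / r * f' (T \<omega>))\<bar> \<le> L / n * \<bar>Y i \<omega>\<bar> ^ 3" for \<omega>
    proof -
      have "\<bar>f (W \<omega>) - f (T \<omega>) - Y i \<omega> / r * f' (T \<omega>)\<bar> \<le> L * (Y i \<omega> / r)\<^sup>2"
        unfolding WT by (rule taylor_lipschitz_deriv[OF f lf])
      then have "\<bar>Y i \<omega>\<bar> * \<bar>f (W \<omega>) - f (T \<omega>) - Y i \<omega> / r * f' (T \<omega>)\<bar> \<le> \<bar>Y i \<omega>\<bar> * (L * (Y i \<omega> / r)\<^sup>2)"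
        by (intro mult_left_mono) auto
      also have "\<dots> = L / n * \<bar>Y i \<omega>\<bar> ^ 3"
        using r by (simp add: power_divide power2_eq_square power3_eq_cube abs_if)
      finally show ?thesis by (simp add: abs_mult)
    qed
    have b1: "\<bar>expectation (\<lambda>\<omega>. Y i \<omega> * f (W \<omega>)) - expectation (\<lambda>\<omega>. f' (T \<omega>)) / r\<bar> \<le> L / n * \<beta>"
    proof -
      have "\<bar>expectation (\<lambda>\<omega>. Y i \<omega> * (f (W \<omega>) - f (T \<omega>) - Y i \<omega> / r * f' (T \<omega>)))\<bar>
        \<le> expectation (\<lambda>\<omega>. L / n * \<bar>Y i \<omega>\<bar> ^ 3)"
      proof -
        have "integrable M (\<lambda>\<omega>. Y i \<omega> * (f (W \<omega>) - f (T \<omega>) - Y i \<omega> / r * f' (T \<omega>)))"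
          by (rule Bochner_Integration.integrable_bound[OF integrable_mult_right[OF i3[of i], of "L / n"]])
            (simp_all only: real_norm_def order_trans[OF rem abs_ge_self] AE_I2, measurable)
        then show ?thesis
          by (rule abs_integral_le) (rule integrable_mult_right[OF i3], rule rem)
      qed
      also have "\<dots> = L / n * \<beta>" using EY[of "\<lambda>y. \<bar>y\<bar> ^ 3" i] by (simp add: \<beta>_def)
      finally show ?thesis unfolding eq .
    qed
    have b2: "\<bar>expectation (\<lambda>\<omega>. f' (W \<omega>)) - expectation (\<lambda>\<omega>. f' (T \<omega>))\<bar> \<le> 2 * L / r"
    proof -
      have "\<bar>expectation (\<lambda>\<omega>. f' (W \<omega>) - f' (T \<omega>))\<bar> \<le> expectation (\<lambda>\<omega>. 2 * L / r * \<bar>Y i \<omega>\<bar>)"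
      proof -
        have "norm (f' (W \<omega>) - f' (T \<omega>)) \<le> 2 * L / r * \<bar>Y i \<omega>\<bar>" for \<omega>
          using lf[of "W \<omega>" "T \<omega>"] r(1) by (simp add: WT)
        then show ?thesis
          unfolding real_norm_def
          by (intro abs_integral_le integrable_mult_right integrable_abs i1
              Bochner_Integration.integrable_diff if' iW iT)
      qed
      also have "\<dots> \<le> 2 * L / r * 1"
        unfolding integral_mult_right_zero using L r(1) by (intro mult_left_mono abs_i) simp_all
      finally show ?thesis using if'[OF iW] if'[OF iT] by simp
    qed
    let ?a = "expectation (\<lambda>\<omega>. Y i \<omega> * f (W \<omega>))" and ?b = "expectation (\<lambda>\<omega>. f' (T \<omega>))"
    have "?b - r * ?a = - (r * (?a - ?b / r))" using r(1) by (simp add: right_diff_distrib)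
    then have "\<bar>?b - r * ?a\<bar> = r * \<bar>?a - ?b / r\<bar>"
      using r(1) by (simp only: abs_minus_cancel abs_mult abs_of_pos)
    also have "\<dots> \<le> r * (L / n * \<beta>)" using r(1) by (intro mult_left_mono b1) simp
    also have "\<dots> = L / r * \<beta>" unfolding r(2)[symmetric] using r(1) by simp
    finally have "\<bar>?b - r * ?a\<bar> \<le> L / r * \<beta>" .
    moreover have "L / r * (2 + \<beta>) = 2 * L / r + L / r * \<beta>" by (simp add: distrib_left)
    ultimately show ?thesis using b2 by linarith
  qed
  have Wf: "W \<omega> * f (W \<omega>) = (\<Sum>i<n. Y i \<omega> * f (W \<omega>)) / r" for \<omega>
    by (subst W_def) (simp add: sum_distrib_right)
  have iWf: "integrable M (\<lambda>\<omega>. W \<omega> * f (W \<omega>))"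
    unfolding Wf using iYf[OF Wm] by (intro integrable_divide_zero integrable_sum) auto
  have "expectation (\<lambda>\<omega>. W \<omega> * f (W \<omega>)) = (\<Sum>i<n. expectation (\<lambda>\<omega>. Y i \<omega> * f (W \<omega>))) / r"
    unfolding Wf using iYf[OF Wm] by simp
  moreover have "E - S / r = (real n * E - r * S) / n" for E S
    unfolding r(2)[symmetric] using r(1) by (simp add: field_simps)
  ultimately have "expectation (\<lambda>\<omega>. f' (W \<omega>)) - expectation (\<lambda>\<omega>. W \<omega> * f (W \<omega>))
      = (\<Sum>i<n. expectation (\<lambda>\<omega>. f' (W \<omega>)) - r * expectation (\<lambda>\<omega>. Y i \<omega> * f (W \<omega>))) / n"
    by (simp add: sum_subtractf sum_distrib_left)
  also have "\<bar>\<dots>\<bar> \<le> (\<Sum>i<n. L / r * (2 + \<beta>)) / n"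
    unfolding abs_divide abs_of_nat using key
    by (intro divide_right_mono order_trans[OF sum_abs] sum_mono) auto
  also have "\<dots> = L / r * (2 + \<beta>)" using n by simp
  finally have "\<bar>expectation (\<lambda>\<omega>. f' (W \<omega>)) - expectation (\<lambda>\<omega>. W \<omega> * f (W \<omega>))\<bar> \<le> L / r * (2 + \<beta>)" .
  moreover have "expectation (\<lambda>\<omega>. f' (W \<omega>)) - expectation (\<lambda>\<omega>. W \<omega> * f (W \<omega>))
     = expectation (\<lambda>\<omega>. h (W \<omega>)) - (\<integral>z. h z \<partial>std_normal_distribution)"
  proof -
    let ?m = "\<integral>z. h z \<partial>std_normal_distribution"
    have h: "h x = (f' x - x * f x) + ?m" for x using stein[of x] by simp
    have "expectation (\<lambda>\<omega>. h (W \<omega>)) = expectation (\<lambda>\<omega>. (f' (W \<omega>) - W \<omega> * f (W \<omega>)) + ?m)"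
      using h by (intro Bochner_Integration.integral_cong refl) blast
    also have "\<dots> = expectation (\<lambda>\<omega>. f' (W \<omega>)) - expectation (\<lambda>\<omega>. W \<omega> * f (W \<omega>)) + ?m"
      using if'[OF iW] iWf by (simp add: prob_space)
    finally show ?thesis by simp
  qed
  ultimately show ?thesis by (simp add: W_def r_def \<beta>_def)
qed

end

section \<open>Random walks whose signs agree\<close>

context prob_space
begin

text \<open>By independence there is positive probability that the first \<open>m\<close> observations fall in
  the first set and the next \<open>k\<close> in the second. On that event the two sums would have opposite signs
  if the stated inequalities held.\<close>

lemma opposite_blocks_impossible:
  fixes X :: "nat \<Rightarrow> 'a \<Rightarrow> real" and S G :: "real \<Rightarrow> real"
  assumes ind: "indep_vars (\<lambda>_. borel) X UNIV"
    and idd: "\<And>i. distr M borel (X i) = \<mu>"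
    and [measurable]: "S \<in> borel_measurable borel" "G \<in> borel_measurable borel"
    and sg: "\<And>k. k \<ge> 1 \<Longrightarrow> AE \<omega> in M. sgn (\<Sum>i<k. S (X i \<omega>)) = sgn (\<Sum>i<k. G (X i \<omega>))"
    and pos: "measure \<mu> {x. S x > u \<and> G x < v} > 0" "measure \<mu> {x. S x > u' \<and> G x < v'} > 0"
    and mk: "m \<ge> 1"
  shows "\<not> (real m * u + real k * u' \<ge> 0 \<and> real m * v + real k * v' \<le> 0)"
proof
  assume uv: "real m * u + real k * u' \<ge> 0 \<and> real m * v + real k * v' \<le> 0"
  have [measurable]: "random_variable borel (X i)" for i
    using ind by (auto simp: indep_vars_def)
  define A where "A i = (if i < m then {x. S x > u \<and> G x < v} else {x. S x > u' \<and> G x < v'})" for i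
  have A[measurable]: "A i \<in> sets borel" for i unfolding A_def by auto
  define E where "E = (\<Inter>i\<in>{..<m + k}. X i -` A i \<inter> space M)"
  have Em: "E \<in> events" unfolding E_def using mk by (intro sets.finite_INT) auto
  have "prob E = (\<Prod>i\<in>{..<m + k}. prob (X i -` A i \<inter> space M))"
    unfolding E_def using mk by (intro indep_varsD_finite[where M'="\<lambda>_. borel"] indep_vars_subset[OF ind]) auto
  also have "\<dots> = (\<Prod>i\<in>{..<m + k}. measure \<mu> (A i))"
  proof (intro prod.cong refl)
    show "prob (X i -` A i \<inter> space M) = measure \<mu> (A i)" for i
      using measure_distr[of "X i" M borel "A i"] idd[of i] by simp
  qed
  also have "\<dots> > 0" using pos by (intro prod_pos) (auto simp: A_def)
  finally have "prob E > 0" .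
  have "\<exists>\<omega>\<in>E. sgn (\<Sum>i<m + k. S (X i \<omega>)) = sgn (\<Sum>i<m + k. G (X i \<omega>))"
  proof (rule ccontr)
    assume "\<not> ?thesis"
    with sg[of "m + k"] mk have "AE \<omega> in M. \<omega> \<notin> E" by auto
    then have "prob E = 0" using Em by (simp add: prob_eq_0)
    with \<open>prob E > 0\<close> show False by simp
  qed
  then obtain \<omega> where \<omega>: "\<omega> \<in> E"
    and eq: "sgn (\<Sum>i<m + k. S (X i \<omega>)) = sgn (\<Sum>i<m + k. G (X i \<omega>))" by blast
  have XA: "X i \<omega> \<in> A i" if "i < m + k" for i using \<omega> that unfolding E_def by blast
  have bounds: "(if i < m then u else u') < S (X i \<omega>) \<and> G (X i \<omega>) < (if i < m then v else v')"
    if "i < m + k" for i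
    using XA[OF that] by (cases "i < m") (simp_all add: A_def)
  have ne: "{..<m + k} \<noteq> {}" using mk by (auto simp: lessThan_empty_iff)
  have block: "(\<Sum>i<m + k. if i < m then a else b) = real m * a + real k * b" for a b :: real
  proof -
    have "{..<m + k} \<inter> {i. i < m} = {..<m}" "{..<m + k} \<inter> - {i. i < m} = {m..<m + k}" by auto
    then show ?thesis by (simp add: sum.If_cases)
  qed
  have "(\<Sum>i<m + k. if i < m then u else u') < (\<Sum>i<m + k. S (X i \<omega>))"
    using bounds by (intro sum_strict_mono ne) simp_all
  moreover have "(\<Sum>i<m + k. G (X i \<omega>)) < (\<Sum>i<m + k. if i < m then v else v')"
    using bounds by (intro sum_strict_mono ne) simp_all
  ultimately show False using uv eq by (simp add: block sgn_if split: if_splits)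
qed

text \<open>Single points may have probability zero, so \<open>x\<close> and \<open>y\<close> are replaced by sets of the form
  \<open>{S > u, G < v}\<close> with rational \<open>u\<close> and \<open>v\<close>. Only countably many of these are null sets, and a
  point outside their union only belongs to sets of positive probability.\<close>

lemma AE_no_opposite_combination:
  fixes X :: "nat \<Rightarrow> 'a \<Rightarrow> real" and S G :: "real \<Rightarrow> real"
  assumes ind: "indep_vars (\<lambda>_. borel) X UNIV"
    and idd: "\<And>i. distr M borel (X i) = \<mu>"
    and S[measurable]: "S \<in> borel_measurable borel" and G[measurable]: "G \<in> borel_measurable borel"
    and sg: "\<And>k. k \<ge> 1 \<Longrightarrow> AE \<omega> in M. sgn (\<Sum>i<k. S (X i \<omega>)) = sgn (\<Sum>i<k. G (X i \<omega>))"
  obtains N where "N \<in> null_sets \<mu>"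
    and "\<And>x y m k. x \<notin> N \<Longrightarrow> y \<notin> N \<Longrightarrow> m \<ge> 1 \<Longrightarrow> k \<ge> 1 \<Longrightarrow>
      real m * S x + real k * S y > 0 \<Longrightarrow> \<not> real m * G x + real k * G y < 0"
proof -
  have [measurable]: "random_variable borel (X i)" for i
    using ind by (auto simp: indep_vars_def)
  have sets: "sets \<mu> = sets borel" and space: "space \<mu> = UNIV" using idd[of 0] by auto
  interpret mu: prob_space \<mu> by (subst idd[of 0, symmetric]) (rule prob_space_distr, simp)
  have Bm: "{x. S x > u \<and> G x < v} \<in> sets \<mu>" for u v unfolding sets by measurable
  have "AE x in \<mu>. \<forall>(u, v)\<in>\<rat> \<times> \<rat>. S x > u \<and> G x < v \<longrightarrow> measure \<mu> {x. S x > u \<and> G x < v} > 0"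
  proof (subst AE_ball_countable)
    show "countable (\<rat> \<times> \<rat> :: (real \<times> real) set)" by (simp add: countable_rat)
    show "\<forall>w\<in>\<rat> \<times> \<rat>. AE x in \<mu>. case w of (u, v) \<Rightarrow>
        S x > u \<and> G x < v \<longrightarrow> measure \<mu> {x. S x > u \<and> G x < v} > 0"
    proof (clarify)
      fix u v :: real
      show "AE x in \<mu>. S x > u \<and> G x < v \<longrightarrow> measure \<mu> {x. S x > u \<and> G x < v} > 0"
      proof (cases "measure \<mu> {x. S x > u \<and> G x < v} > 0")
        case False
        then have "measure \<mu> {x. S x > u \<and> G x < v} = 0" by (simp add: zero_less_measure_iff)
        then have "AE x in \<mu>. x \<notin> {x. S x > u \<and> G x < v}"
          using mu.prob_eq_0[OF Bm] by simp
        then show ?thesis by eventually_elim auto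
      qed simp
    qed
  qed
  then obtain N where N: "N \<in> null_sets \<mu>"
    and good: "\<And>x u v. x \<notin> N \<Longrightarrow> u \<in> \<rat> \<Longrightarrow> v \<in> \<rat> \<Longrightarrow> S x > u \<Longrightarrow> G x < v \<Longrightarrow>
      measure \<mu> {x. S x > u \<and> G x < v} > 0"
    by (rule AE_E3) (auto simp: space)
  show thesis
  proof (rule that[OF N])
    fix x y :: real and m k :: nat
    assume xy: "x \<notin> N" "y \<notin> N" and mk: "m \<ge> 1" "k \<ge> 1" and s: "real m * S x + real k * S y > 0"
    show "\<not> real m * G x + real k * G y < 0"
    proof
      assume g: "real m * G x + real k * G y < 0"
      \<comment> \<open>The thresholds \<open>w / m\<close> and \<open>- w / k\<close>, repeated \<open>m\<close> and \<open>k\<close> times, add up to 0, and likewise for \<open>z\<close>.\<close>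
      obtain w where w: "w \<in> \<rat>" "- (real k * S y) < w" "w < real m * S x"
        using Rats_dense_in_real[of "- (real k * S y)" "real m * S x"] s by auto
      obtain z where z: "z \<in> \<rat>" "real m * G x < z" "z < - (real k * G y)"
        using Rats_dense_in_real[of "real m * G x" "- (real k * G y)"] g by auto
      have "measure \<mu> {t. S t > w / real m \<and> G t < z / real m} > 0"
        using w z mk by (intro good[OF xy(1)]) (auto simp: field_simps intro!: Rats_divide)
      moreover have "measure \<mu> {t. S t > - w / real k \<and> G t < - z / real k} > 0"
        using w z mk by (intro good[OF xy(2)]) (auto simp: field_simps intro!: Rats_divide)
      ultimately show False
        using opposite_blocks_impossible[OF ind idd S G sg _ _ mk(1), of "w / real m" "z / real m"
            "- w / real k" "- z / real k" k] mk
        by simp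
    qed
  qed
qed

text \<open>The naturals come from a rational number \<open>k / m\<close> between \<open>c / d\<close> and \<open>a / b\<close>.\<close>

lemma ratio_separating_naturals:
  fixes a b c d :: real
  assumes "b > 0" "c > 0" "d > 0" "a * d > b * c"
  obtains m k :: nat where "m \<ge> 1" "k \<ge> 1" "real m * a > real k * b" "real m * c < real k * d"
proof -
  have "c / d < a / b" using assms by (simp add: field_simps)
  then obtain q where q: "q \<in> \<rat>" "c / d < q" "q < a / b" using Rats_dense_in_real by blast
  have "q > 0" using q assms by (meson divide_pos_pos less_trans)
  obtain k m :: nat where km: "m \<noteq> 0" "\<bar>q\<bar> = real k / real m"
    using Rats_abs_nat_div_natE[OF q(1)] by blast
  have "real k > 0" using km \<open>q > 0\<close> by (cases "k = 0") auto
  moreover have "real m * a > real k * b" "real m * c < real k * d"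
  proof -
    have k: "real k = q * real m" and m: "real m > 0" using km \<open>q > 0\<close> by (auto simp: field_simps)
    have "b * q < a" "c < d * q" using q assms by (auto simp: field_simps)
    then have "real m * (b * q) < real m * a" "real m * c < real m * (d * q)" using m by simp_all
    then show "real m * a > real k * b" "real m * c < real k * d" by (simp_all add: k ac_simps)
  qed
  ultimately show thesis using km by (intro that[of m k]) auto
qed

text \<open>If \<open>S\<close> and \<open>G\<close> had different ratios at a point with positive and a point with negative
  values, a fraction \<open>k / m\<close> between the ratios of their absolute values would give
  an integer combination that is positive for one function and negative for the other. So \<open>S / G\<close>
  takes the same value at every positive and every negative point, and as both kinds exist, this
  value is a constant.\<close>

lemma proportional_of_equal_signs:
  fixes X :: "nat \<Rightarrow> 'a \<Rightarrow> real" and S G :: "real \<Rightarrow> real"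
  assumes ind: "indep_vars (\<lambda>_. borel) X UNIV"
    and idd: "\<And>i. distr M borel (X i) = \<mu>"
    and S[measurable]: "S \<in> borel_measurable borel" and G[measurable]: "G \<in> borel_measurable borel"
    and sg: "\<And>k. k \<ge> 1 \<Longrightarrow> AE \<omega> in M. sgn (\<Sum>i<k. S (X i \<omega>)) = sgn (\<Sum>i<k. G (X i \<omega>))"
    and pos: "\<not> (AE x in \<mu>. S x \<le> 0)" and neg: "\<not> (AE x in \<mu>. S x \<ge> 0)"
  obtains c where "c > 0" "AE x in \<mu>. S x = c * G x"
proof -
  have Xm[measurable]: "random_variable borel (X i)" for i
    using ind by (auto simp: indep_vars_def)
  have space: "space \<mu> = UNIV" using idd[of 0] by auto
  obtain N1 where N1: "N1 \<in> null_sets \<mu>"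
    "\<And>x y m k. x \<notin> N1 \<Longrightarrow> y \<notin> N1 \<Longrightarrow> m \<ge> 1 \<Longrightarrow> k \<ge> 1 \<Longrightarrow>
      real m * S x + real k * S y > 0 \<Longrightarrow> \<not> real m * G x + real k * G y < 0"
    using AE_no_opposite_combination[OF ind idd S G sg] by blast
  have sg': "AE \<omega> in M. sgn (\<Sum>i<k. G (X i \<omega>)) = sgn (\<Sum>i<k. S (X i \<omega>))" if "k \<ge> 1" for k
    using sg[OF that] by eventually_elim simp
  obtain N2 where N2: "N2 \<in> null_sets \<mu>"
    "\<And>x y m k. x \<notin> N2 \<Longrightarrow> y \<notin> N2 \<Longrightarrow> m \<ge> 1 \<Longrightarrow> k \<ge> 1 \<Longrightarrow>
      real m * G x + real k * G y > 0 \<Longrightarrow> \<not> real m * S x + real k * S y < 0"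
    using AE_no_opposite_combination[OF ind idd G S sg'] by blast
  have "AE \<omega> in M. sgn (S (X 0 \<omega>)) = sgn (G (X 0 \<omega>))"
    using sg[of 1] by simp
  then have "AE x in \<mu>. sgn (S x) = sgn (G x)"
    by (subst idd[of 0, symmetric]) (simp add: AE_distr_iff)
  then obtain N3 where N3: "N3 \<in> null_sets \<mu>" "\<And>x. x \<notin> N3 \<Longrightarrow> sgn (S x) = sgn (G x)"
    by (rule AE_E3) (auto simp: space)
  define N where "N = N1 \<union> N2 \<union> N3"
  have N: "N \<in> null_sets \<mu>" unfolding N_def using N1 N2 N3 by auto
  have AEN: "AE x in \<mu>. x \<notin> N" by (rule AE_not_in[OF N])
  have cross: "S x * G y = S y * G x" if xy: "x \<notin> N" "y \<notin> N" "G x > 0" "G y < 0" for x y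
  proof -
    have sgn: "sgn (S x) = sgn (G x)" "sgn (S y) = sgn (G y)" using N3(2) xy by (auto simp: N_def)
    then have S: "S x > 0" "S y < 0" using xy by (auto simp: sgn_if split: if_splits)
    have "\<not> S x * (- G y) > (- S y) * G x"
    proof
      assume "S x * (- G y) > (- S y) * G x"
      then obtain m k :: nat where "m \<ge> 1" "k \<ge> 1" "real m * S x > real k * (- S y)"
        "real m * G x < real k * (- G y)"
        using ratio_separating_naturals[of "- S y" "G x" "- G y" "S x"] S xy by auto
      then show False using N1(2)[of x y m k] xy by (auto simp: N_def)
    qed
    moreover have "\<not> S x * (- G y) < (- S y) * G x"
    proof
      assume "S x * (- G y) < (- S y) * G x"
      then have "G x * (- S y) > (- G y) * S x" by (simp add: mult.commute)
      then obtain m k :: nat where "m \<ge> 1" "k \<ge> 1" "real m * G x > real k * (- G y)"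
        "real m * S x < real k * (- S y)"
        using ratio_separating_naturals[of "- G y" "S x" "- S y" "G x"] S xy by auto
      then show False using N2(2)[of x y m k] xy by (auto simp: N_def)
    qed
    ultimately show ?thesis by simp
  qed
  have "\<exists>x. x \<notin> N \<and> S x > 0"
  proof (rule ccontr)
    assume *: "\<not> ?thesis"
    have "AE x in \<mu>. S x \<le> 0" using AEN by eventually_elim (use * in force)
    with pos show False by contradiction
  qed
  then obtain x0 where x0: "x0 \<notin> N" "S x0 > 0" by blast
  have "\<exists>y. y \<notin> N \<and> S y < 0"
  proof (rule ccontr)
    assume *: "\<not> ?thesis"
    have "AE x in \<mu>. S x \<ge> 0" using AEN by eventually_elim (use * in force)
    with neg show False by contradiction
  qed
  then obtain y0 where y0: "y0 \<notin> N" "S y0 < 0" by blast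
  have G0: "G x0 > 0" "G y0 < 0"
    using N3(2)[of x0] N3(2)[of y0] x0 y0 by (auto simp: N_def sgn_if split: if_splits)
  define c where "c = S x0 / G x0"
  have "c > 0" using x0 G0 by (simp add: c_def)
  have c': "c = S y0 / G y0"
    using cross[OF x0(1) y0(1) G0] G0 unfolding c_def by (simp add: divide_eq_eq eq_divide_eq mult.commute)
  have "S x = c * G x" if x: "x \<notin> N" for x
  proof (cases "G x" "0 :: real" rule: linorder_cases)
    case less
    from cross[OF x0(1) x G0(1) less] show ?thesis using G0 by (simp add: c_def field_simps)
  next
    case equal
    with N3(2)[of x] x show ?thesis by (auto simp: N_def sgn_if split: if_splits)
  next
    case greater
    from cross[OF x y0(1) greater G0(2)] show ?thesis using G0 by (simp add: c' field_simps)
  qed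
  then have "AE x in \<mu>. S x = c * G x" using AEN by auto
  with \<open>c > 0\<close> show thesis by (rule that)
qed

end

section \<open>Functions whose critical points are strict maxima\<close>

lemma einterval_between:
  assumes "u \<in> einterval a b" "v \<in> einterval a b" "u \<le> x" "x \<le> v"
  shows "x \<in> einterval a b"
proof -
  have "a < ereal u" "ereal v < b" "ereal u \<le> ereal x" "ereal x \<le> ereal v"
    using assms by (auto simp: einterval_def)
  then have "a < ereal x" "ereal x < b" using less_le_trans le_less_trans by blast+
  then show ?thesis by (simp add: einterval_def)
qed

text \<open>If the derivative at \<open>t\<close> were not positive, \<open>l\<close> would have a minimum over \<open>{t..s}\<close> at a
  critical point other than \<open>s\<close>, but just after each critical point \<open>l\<close> takes smaller values.\<close>

lemma no_descent_to_lower_value: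
  fixes l l' l'' :: "real \<Rightarrow> real"
  assumes d1: "\<And>x. x \<in> {t..s} \<Longrightarrow> (l has_real_derivative l' x) (at x)"
    and d2: "\<And>x. x \<in> {t..s} \<Longrightarrow> (l' has_real_derivative l'' x) (at x)"
    and crit: "\<And>x. x \<in> {t..s} \<Longrightarrow> l' x = 0 \<Longrightarrow> l'' x < 0"
    and ts: "t < s" "l t \<le> l s"
  shows "l' t > 0"
proof (rule ccontr)
  assume neg: "\<not> l' t > 0"
  have "continuous_on {t..s} l" 
    by (rule DERIV_continuous_on[OF has_field_derivative_at_within[OF d1]])
  moreover have "{t..s} \<noteq> {}" using ts by simp
  ultimately obtain p0 where p0: "p0 \<in> {t..s}" "\<And>x. x \<in> {t..s} \<Longrightarrow> l p0 \<le> l x"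
    using continuous_attains_inf[OF compact_Icc] by blast
  \<comment> \<open>If the minimum is attained at \<open>s\<close>, then \<open>l t \<le> l s\<close> makes \<open>t\<close> a minimum as well.\<close>
  define p where "p = (if p0 = s then t else p0)"
  have p: "t \<le> p" "p < s" using p0(1) ts by (auto simp: p_def)
  have pmin: "l p \<le> l x" if "x \<in> {t..s}" for x
    using p0(2)[OF that] ts(2) by (auto simp: p_def)
  have pt: "p \<in> {t..s}" using p by auto
  have "l' p = 0"
  proof (cases "p = t")
    case True
    have "\<not> l' p < 0"
    proof
      assume "l' p < 0"
      then obtain d where d: "d > 0" "\<And>h. h > 0 \<Longrightarrow> h < d \<Longrightarrow> l (p + h) < l p"
        using DERIV_neg_dec_right[OF d1[OF pt]] by blast
      define h where "h = min (d / 2) (s - p)"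
      have "h > 0" "h < d" "p + h \<in> {t..s}" using d(1) p by (auto simp: h_def min_def)
      with d(2)[of h] pmin[of "p + h"] show False by linarith
    qed
    with neg True show ?thesis by simp
  next
    case False
    then have "t < p" using p by simp
    show ?thesis
    proof (rule DERIV_local_min[OF d1[OF pt]])
      show "0 < min (p - t) (s - p)" using \<open>t < p\<close> p by simp
      show "\<forall>y. \<bar>p - y\<bar> < min (p - t) (s - p) \<longrightarrow> l p \<le> l y"
      proof (intro allI impI)
        fix y assume "\<bar>p - y\<bar> < min (p - t) (s - p)"
        then have "t \<le> y" "y \<le> s" by linarith+
        then show "l p \<le> l y" by (intro pmin) simp
      qed
    qed
  qed
  then have "l'' p < 0" using crit pt by simp
  then obtain d where d: "d > 0" "\<And>h. h > 0 \<Longrightarrow> h < d \<Longrightarrow> l' (p + h) < l' p"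
    using DERIV_neg_dec_right[OF d2[OF pt]] by blast
  define h where "h = min (d / 2) (s - p)"
  have h: "h > 0" "h < d" "p + h \<le> s" using d(1) p by (auto simp: h_def min_def)
  have "l p > l (p + h)"
  proof (rule DERIV_neg_imp_decreasing_open[of p "p + h" l])
    fix x assume x: "p < x" "x < p + h"
    have "l' x < 0" using d(2)[of "x - p"] x h \<open>l' p = 0\<close> by simp
    then show "\<exists>y. (l has_real_derivative y) (at x) \<and> y < 0"
      using d1[of x] x h p by (intro exI[of _ "l' x"]) auto
  next
    show "continuous_on {p..p + h} l"
      by (rule continuous_on_subset[OF \<open>continuous_on {t..s} l\<close>]) (use p h in auto)
  qed (use h in auto)
  moreover have "l p \<le> l (p + h)" by (rule pmin) (use h p in simp)
  ultimately show False by simp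
qed

text \<open>Left of the maximizer this is \<open>no_descent_to_lower_value\<close>, and right of it the same lemma
  for the reflected function \<open>l (- x)\<close>.\<close>

lemma sgn_deriv_eq_sgn_maximizer_diff:
  fixes l l' l'' :: "real \<Rightarrow> real"
  assumes \<Theta>: "\<Theta> = einterval a b"
    and d1: "\<And>x. x \<in> \<Theta> \<Longrightarrow> (l has_real_derivative l' x) (at x)"
    and d2: "\<And>x. x \<in> \<Theta> \<Longrightarrow> (l' has_real_derivative l'' x) (at x)"
    and crit: "\<And>x. x \<in> \<Theta> \<Longrightarrow> l' x = 0 \<Longrightarrow> l'' x < 0"
    and max: "m \<in> \<Theta>" "\<And>x. x \<in> \<Theta> \<Longrightarrow> l x \<le> l m"
    and t: "t \<in> \<Theta>"
  shows "sgn (l' t) = sgn (m - t)"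
proof (cases t m rule: linorder_cases)
  case less
  have sub: "{t..m} \<subseteq> \<Theta>" using einterval_between[of t a b m] t max(1) unfolding \<Theta> by auto
  have "l' t > 0"
    by (rule no_descent_to_lower_value[of t m l l' l'']) (use sub d1 d2 crit less max(2)[OF t] in auto)
  then show ?thesis using less by simp
next
  case equal
  have "eventually (\<lambda>y. y \<in> \<Theta>) (nhds m)"
    using max(1) by (intro eventually_nhds_in_open) (auto simp: \<Theta>)
  then obtain d where "d > 0" "\<And>y. dist y m < d \<Longrightarrow> y \<in> \<Theta>"
    unfolding eventually_nhds_metric by auto
  then have "l' m = 0"
    by (intro DERIV_local_max[OF d1[OF max(1)], of d]) (auto simp: dist_real_def abs_minus_commute max(2))
  with equal show ?thesis by simp
next
  case greater
  have sub: "- x \<in> \<Theta>" if "x \<in> {- t..- m}" for x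
    using einterval_between[of m a b t "- x"] t max(1) that unfolding \<Theta> by auto
  have "- l' (- (- t)) > 0"
  proof (rule no_descent_to_lower_value[of "- t" "- m" "\<lambda>x. l (- x)" "\<lambda>x. - l' (- x)" "\<lambda>x. l'' (- x)"])
    fix x assume "x \<in> {- t..- m}"
    note sub[OF this]
    then show "((\<lambda>x. l (- x)) has_real_derivative - l' (- x)) (at x)"
      using DERIV_mirror[of l "l' (- x)" x] d1 by simp
    show "((\<lambda>x. - l' (- x)) has_real_derivative l'' (- x)) (at x)"
      using DERIV_minus[of "\<lambda>x. l' (- x)" "- l'' (- x)"] DERIV_mirror[of l' "l'' (- x)" x] d2 \<open>- x \<in> \<Theta>\<close>
      by simp
    show "- l' (- x) = 0 \<Longrightarrow> l'' (- x) < 0" using crit \<open>- x \<in> \<Theta>\<close> by simp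
  qed (use greater max(2)[OF t] in auto)
  then show ?thesis using greater by simp
qed

lemma maximum_attained_of_boundary_limits:
  fixes l :: "real \<Rightarrow> real"
  assumes ab: "a < b" and \<Theta>: "\<Theta> = einterval a b" and cont: "continuous_on \<Theta> l"
    and lim: "filterlim (l \<circ> real_of_ereal) at_bot (at_right a)" "filterlim (l \<circ> real_of_ereal) at_bot (at_left b)"
  obtains m where "m \<in> \<Theta>" "\<And>x. x \<in> \<Theta> \<Longrightarrow> l x \<le> l m"
proof -
  obtain t where t: "a < ereal t" "ereal t < b" using ereal_dense2[OF ab] by blast
  have "eventually (\<lambda>y. (l \<circ> real_of_ereal) y \<le> l t) (at_right a)"
    "eventually (\<lambda>y. (l \<circ> real_of_ereal) y \<le> l t) (at_left b)"
    using lim unfolding filterlim_at_bot by auto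
  then obtain u v where u: "u > a" "\<And>y. a < y \<Longrightarrow> y < u \<Longrightarrow> l (real_of_ereal y) \<le> l t"
    and v: "v < b" "\<And>y. v < y \<Longrightarrow> y < b \<Longrightarrow> l (real_of_ereal y) \<le> l t"
    unfolding eventually_at_right[OF ab] eventually_at_left[OF ab] by auto
  obtain c where c: "a < ereal c" "ereal c < min u t" using ereal_dense2[of a "min u t"] u t by auto
  obtain d where d: "max v t < ereal d" "ereal d < b" using ereal_dense2[of "max v t" b] v t by auto
  have sub: "{c..d} \<subseteq> \<Theta>" 
  proof -
    have "ereal c < b" "a < ereal d" using c d t less_trans by (metis min_less_iff_conj max_less_iff_conj)+
    then show ?thesis using einterval_between[of c a b d] c d unfolding \<Theta> by (auto simp: einterval_def)
  qed
  have cd: "c < t" "t < d" using c d by auto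
  obtain m where m: "m \<in> {c..d}" "\<And>x. x \<in> {c..d} \<Longrightarrow> l x \<le> l m"
    using continuous_attains_sup[of "{c..d}" l] continuous_on_subset[OF cont sub] cd by auto
  show thesis
  proof (rule that[of m])
    show "m \<in> \<Theta>" using m sub by auto
    fix x assume x: "x \<in> \<Theta>"
    consider "x \<in> {c..d}" | "x < c" | "x > d" by force
    then show "l x \<le> l m"
    proof cases
      case 1 then show ?thesis by (rule m)
    next
      case 2
      then have "ereal x < u" using c(2) less_trans[of "ereal x" "ereal c" u] by simp
      then have "l x \<le> l t" using u(2)[of "ereal x"] x by (simp add: \<Theta> einterval_def)
      also have "\<dots> \<le> l m" using m(2)[of t] cd by auto
      finally show ?thesis .
    next
      case 3
      then have "ereal x > v" using d(1) less_trans[of v "ereal d" "ereal x"] by simp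
      then have "l x \<le> l t" using v(2)[of "ereal x"] x by (simp add: \<Theta> einterval_def)
      also have "\<dots> \<le> l m" using m(2)[of t] cd by auto
      finally show ?thesis .
    qed
  qed
qed

section \<open>The likelihood equation\<close>

locale parametric_family =
  fixes a b :: ereal and \<Theta> \<X> :: "real set" and \<nu> :: "real measure" and f :: "real \<Rightarrow> real \<Rightarrow> real"
  assumes ab: "a < b" and \<Theta>: "\<Theta> = einterval a b"
    and fam: "density_family \<nu> \<Theta> \<X> f"
    and A: "\<And>k x. k \<ge> 1 \<Longrightarrow> x \<in> {..<k} \<rightarrow> \<X> \<Longrightarrow>
           cond_A1 f \<Theta> k x \<and> cond_A2 f a b k x \<and> cond_A3 f \<Theta> k x"
    and R2: "cond_R2 \<nu> f \<Theta>"
begin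

definition score :: "real \<Rightarrow> real \<Rightarrow> real" where
  "score \<theta> x = deriv (\<lambda>t. f t x) \<theta> / f \<theta> x"

lemma open_Theta: "open \<Theta>" by (simp add: \<Theta>)

lemma is_interval_Theta: "is_interval \<Theta>"
  unfolding is_interval_1 \<Theta> using einterval_between by blast

lemma sets_nu: "sets \<nu> = sets borel"
  using fam by (auto simp: density_family_def reference_measure_def)

lemma measurable_nu_iff: "measurable \<nu> N = measurable borel N"
  by (rule measurable_cong_sets[OF sets_nu refl])

lemma f_measurable: "\<theta> \<in> \<Theta> \<Longrightarrow> f \<theta> \<in> borel_measurable borel"
  and f_nonneg: "\<theta> \<in> \<Theta> \<Longrightarrow> f \<theta> x \<ge> 0"
  and f_pos_iff: "\<theta> \<in> \<Theta> \<Longrightarrow> f \<theta> x > 0 \<longleftrightarrow> x \<in> \<X>"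
  and nn_integral_f: "\<theta> \<in> \<Theta> \<Longrightarrow> (\<integral>\<^sup>+ x. ennreal (f \<theta> x) \<partial>\<nu>) = 1"
  using fam by (auto simp: density_family_def)

lemma f_eq_0: "\<theta> \<in> \<Theta> \<Longrightarrow> x \<notin> \<X> \<Longrightarrow> f \<theta> x = 0"
  using f_pos_iff[of \<theta> x] f_nonneg[of \<theta> x] by linarith

lemma Theta_nonempty: "\<exists>\<theta>. \<theta> \<in> \<Theta>"
  using ereal_dense2[OF ab] by (auto simp: \<Theta> einterval_def)

lemma support_measurable: "\<X> \<in> sets borel"
proof -
  obtain \<theta> where t: "\<theta> \<in> \<Theta>" using Theta_nonempty by blast
  have "\<X> = {x\<in>space borel. f \<theta> x > 0}" using f_pos_iff[OF t] by auto
  also have "\<dots> \<in> sets borel" using f_measurable[OF t] by measurable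
  finally show ?thesis .
qed

lemma f_deriv:
  assumes "\<theta> \<in> \<Theta>" "j < 3"
  shows "((deriv ^^ j) (\<lambda>t. f t x) has_real_derivative (deriv ^^ Suc j) (\<lambda>t. f t x) \<theta>) (at \<theta>)"
  using R2 assms by (auto simp: cond_R2_def times_differentiable_on_def DERIV_deriv_iff_real_differentiable)

lemma integrable_f_deriv:
  "\<theta> \<in> \<Theta> \<Longrightarrow> j < 3 \<Longrightarrow> integrable \<nu> (\<lambda>x. (deriv ^^ Suc j) (\<lambda>t. f t x) \<theta>)"
  and integral_f_deriv: "\<theta> \<in> \<Theta> \<Longrightarrow> j < 3 \<Longrightarrow>
    ((\<lambda>s. \<integral>x. (deriv ^^ j) (\<lambda>t. f t x) s \<partial>\<nu>) has_real_derivative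
           (\<integral>x. (deriv ^^ Suc j) (\<lambda>t. f t x) \<theta> \<partial>\<nu>)) (at \<theta>)"
  using R2 by (auto simp: cond_R2_def)

lemma score_measurable: 
  assumes "\<theta> \<in> \<Theta>"
  shows "score \<theta> \<in> borel_measurable borel"
proof -
  have "(\<lambda>x. deriv (\<lambda>t. f t x) \<theta>) \<in> borel_measurable \<nu>"
    using integrable_f_deriv[OF assms, of 0] by auto
  then show ?thesis
    using f_measurable[OF assms] unfolding measurable_nu_iff score_def[abs_def] by measurable
qed

lemma log_f_deriv:
  assumes "\<theta> \<in> \<Theta>" "x \<in> \<X>"
  shows "((\<lambda>t. ln (f t x)) has_real_derivative score \<theta> x) (at \<theta>)"
  using f_deriv[OF assms(1), of 0 x] f_pos_iff[OF assms(1)] assms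
  by (auto intro!: derivative_eq_intros simp: score_def)

lemma log_likelihood_deriv:
  assumes x: "x \<in> {..<k} \<rightarrow> \<X>" and t: "\<theta> \<in> \<Theta>"
  shows "(log_likelihood f k x has_real_derivative (\<Sum>i<k. score \<theta> (x i))) (at \<theta>)"
proof (rule has_field_derivative_transform_within_open[OF _ open_Theta t])
  show "((\<lambda>t. \<Sum>i<k. ln (f t (x i))) has_real_derivative (\<Sum>i<k. score \<theta> (x i))) (at \<theta>)"
    by (rule DERIV_sum) (use x t in \<open>auto intro!: log_f_deriv\<close>)
  show "(\<Sum>i<k. ln (f s (x i))) = log_likelihood f k x s" if "s \<in> \<Theta>" for s
    unfolding log_likelihood_def likelihood_def
  proof (subst ln_prod)
    have "f s (x i) > 0" if "i < k" for i using x that f_pos_iff[OF \<open>s \<in> \<Theta>\<close>] by auto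
    then show "f s (x i) \<noteq> 0" if "i \<in> {..<k}" for i using that by force
  qed simp_all
qed

lemma mle_in_Theta_and_sgn_score:
  assumes k: "k \<ge> 1" and x: "x \<in> {..<k} \<rightarrow> \<X>"
  shows "mle f \<Theta> \<X> k x \<in> \<Theta>"
    and "\<theta> \<in> \<Theta> \<Longrightarrow> sgn (\<Sum>i<k. score \<theta> (x i)) = sgn (mle f \<Theta> \<X> k x - \<theta>)"
proof -
  let ?l = "log_likelihood f k x"
  have cond: "cond_A1 f \<Theta> k x" "cond_A2 f a b k x" "cond_A3 f \<Theta> k x" using A[OF k x] by auto
  have dl: "(?l has_real_derivative deriv ?l t) (at t)" if "t \<in> \<Theta>" for t
    using log_likelihood_deriv[OF x that] by (metis DERIV_imp_deriv)
  have d2: "(deriv ?l has_real_derivative deriv (deriv ?l) t) (at t)" if "t \<in> \<Theta>" for t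
  proof -
    have "(deriv ^^ 1) ?l differentiable (at t)"
      using cond(1) that unfolding cond_A1_def times_differentiable_on_def by (auto simp del: funpow.simps)
    then show ?thesis by (simp add: DERIV_deriv_iff_real_differentiable)
  qed
  have crit: "deriv (deriv ?l) t < 0" if "t \<in> \<Theta>" "deriv ?l t = 0" for t
    using cond(3) that by (auto simp: cond_A3_def numeral_2_eq_2)
  have "continuous_on \<Theta> ?l"
    by (rule DERIV_continuous_on[OF has_field_derivative_at_within[OF dl]])
  then obtain m0 where m0: "m0 \<in> \<Theta>" "\<And>t. t \<in> \<Theta> \<Longrightarrow> ?l t \<le> ?l m0"
    using maximum_attained_of_boundary_limits[OF ab \<Theta>] cond(2) unfolding cond_A2_def by blast
  define m where "m = mle f \<Theta> \<X> k x"
  have "is_arg_max ?l (\<lambda>t. t \<in> \<Theta>) m0" using m0 by (simp add: is_arg_max_linorder)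
  then have "is_arg_max ?l (\<lambda>t. t \<in> \<Theta>) m"
    unfolding m_def mle_def arg_max_on_def arg_max_def using x by (simp add: someI[of _ m0])
  then have m: "m \<in> \<Theta>" "\<And>t. t \<in> \<Theta> \<Longrightarrow> ?l t \<le> ?l m" by (auto simp: is_arg_max_linorder)
  then show "mle f \<Theta> \<X> k x \<in> \<Theta>" by (simp add: m_def)
  assume t: "\<theta> \<in> \<Theta>"
  have "sgn (deriv ?l \<theta>) = sgn (m - \<theta>)"
    by (rule sgn_deriv_eq_sgn_maximizer_diff[OF \<Theta> dl d2 crit m t])
  then show "sgn (\<Sum>i<k. score \<theta> (x i)) = sgn (mle f \<Theta> \<X> k x - \<theta>)"
    using DERIV_imp_deriv[OF log_likelihood_deriv[OF x t]] by (simp add: m_def)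
qed

text \<open>The estimator is a maximizer selected by Hilbert choice, so its measurability rests on the
  description of \<open>\<theta> < T\<close> by the sign of the score sum.\<close>

lemma mle_measurable:
  assumes k: "k \<ge> 1" and X: "\<And>i. X i \<in> borel_measurable M"
  shows "(\<lambda>\<omega>. mle f \<Theta> \<X> k (\<lambda>i. X i \<omega>)) \<in> borel_measurable M"
proof (rule borel_measurable_iff_greater[THEN iffD2], intro allI)
  fix \<theta> :: real
  let ?E = "{\<omega>\<in>space M. \<forall>i\<in>{..<k}. X i \<omega> \<in> \<X>}"
  have E: "?E \<in> sets M"
    using X support_measurable by (intro sets.sets_Collect_finite_All) auto
  have outside: "mle f \<Theta> \<X> k (\<lambda>i. X i \<omega>) = undefined" if "\<omega> \<in> space M - ?E" for \<omega>
    using that by (auto simp: mle_def)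
  note inside = mle_in_Theta_and_sgn_score[OF k, of "\<lambda>i. X i _"]
  have in1: "{\<omega>\<in>?E. \<theta> < mle f \<Theta> \<X> k (\<lambda>i. X i \<omega>)} \<in> sets M"
  proof (cases "\<theta> \<in> \<Theta>")
    case True
    have "{\<omega>\<in>?E. \<theta> < mle f \<Theta> \<X> k (\<lambda>i. X i \<omega>)} = ?E \<inter> {\<omega>\<in>space M. 0 < (\<Sum>i<k. score \<theta> (X i \<omega>))}"
    proof -
      have "\<theta> < mle f \<Theta> \<X> k (\<lambda>i. X i \<omega>) \<longleftrightarrow> 0 < (\<Sum>i<k. score \<theta> (X i \<omega>))" if "\<omega> \<in> ?E" for \<omega>
        using inside(2)[OF _ True, of \<omega>] that by (auto simp: sgn_if split: if_splits)
      then show ?thesis by auto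
    qed
    also have "\<dots> \<in> sets M"
      using E X score_measurable[OF True] by measurable
    finally show ?thesis .
  next
    case False
    then have "(\<forall>t\<in>\<Theta>. \<theta> < t) \<or> (\<forall>t\<in>\<Theta>. t \<le> \<theta>)"
      using is_interval_Theta unfolding is_interval_1 by (meson not_less less_imp_le)
    then have "{\<omega>\<in>?E. \<theta> < mle f \<Theta> \<X> k (\<lambda>i. X i \<omega>)} = ?E \<or> {\<omega>\<in>?E. \<theta> < mle f \<Theta> \<X> k (\<lambda>i. X i \<omega>)} = {}"
      using inside(1) by (auto simp: not_less)
    then show ?thesis
    proof
      assume *: "{\<omega>\<in>?E. \<theta> < mle f \<Theta> \<X> k (\<lambda>i. X i \<omega>)} = {}"
      show ?thesis unfolding * by simp
    qed (use E in simp)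
  qed
  have "{\<omega>\<in>space M. \<theta> < mle f \<Theta> \<X> k (\<lambda>i. X i \<omega>)}
     = {\<omega>\<in>?E. \<theta> < mle f \<Theta> \<X> k (\<lambda>i. X i \<omega>)} \<union> (if \<theta> < undefined then space M - ?E else {})"
    (is "?L = ?R")
  proof (rule set_eqI)
    fix \<omega> show "\<omega> \<in> ?L \<longleftrightarrow> \<omega> \<in> ?R"
    proof (cases "\<omega> \<in> ?E")
      case False
      then show ?thesis using outside[of \<omega>] by (cases "\<omega> \<in> space M") simp_all
    qed auto
  qed
  then show "{\<omega>\<in>space M. \<theta> < mle f \<Theta> \<X> k (\<lambda>i. X i \<omega>)} \<in> sets M"
    using in1 E by auto
qed

end

section \<open>Moments of the score\<close>

context parametric_family
begin

abbreviation "\<mu> \<equiv> law \<nu> f"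

lemma law_sets: "sets (\<mu> \<theta>) = sets borel"
  by (simp add: law_def sets_nu)

lemma law_prob_space:
  assumes "\<theta> \<in> \<Theta>" shows "prob_space (\<mu> \<theta>)"
proof
  show "emeasure (\<mu> \<theta>) (space (\<mu> \<theta>)) = 1"
    using f_measurable[OF assms] nn_integral_f[OF assms]
    by (simp add: law_def emeasure_density measurable_nu_iff)
qed

text \<open>All laws of the family have the same null sets, since their densities are positive on the
  same set. This allows statements about the score at \<open>\<theta>\<close> to be made under the law at \<open>\<theta>\<^sub>0\<close>.\<close>

lemma AE_law_iff:
  assumes "\<theta> \<in> \<Theta>"
  shows "(AE x in \<mu> \<theta>. P x) \<longleftrightarrow> (AE x in \<nu>. x \<in> \<X> \<longrightarrow> P x)"
  unfolding law_def using f_measurable[OF assms] f_pos_iff[OF assms]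
  by (subst AE_density) (auto simp: measurable_nu_iff)

lemma AE_law_in_support: "\<theta> \<in> \<Theta> \<Longrightarrow> AE x in \<mu> \<theta>. x \<in> \<X>"
  by (simp add: AE_law_iff)

lemma integrable_law_iff:
  assumes "\<theta> \<in> \<Theta>" "k \<in> borel_measurable borel"
  shows "integrable (\<mu> \<theta>) k \<longleftrightarrow> integrable \<nu> (\<lambda>x. f \<theta> x * k x)"
  unfolding law_def using assms f_measurable[OF assms(1)] f_nonneg[OF assms(1)]
  by (subst integrable_density) (auto simp: measurable_nu_iff)

lemma integral_law:
  fixes k :: "real \<Rightarrow> real"
  assumes "\<theta> \<in> \<Theta>" "k \<in> borel_measurable borel"
  shows "(\<integral>x. k x \<partial>\<mu> \<theta>) = (\<integral>x. f \<theta> x * k x \<partial>\<nu>)"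
  unfolding law_def using assms f_measurable[OF assms(1)] f_nonneg[OF assms(1)]
  by (subst integral_density) (auto simp: measurable_nu_iff)

lemma f_deriv_outside_support:
  assumes x: "x \<notin> \<X>"
  shows "\<theta> \<in> \<Theta> \<Longrightarrow> j \<le> 3 \<Longrightarrow> (deriv ^^ j) (\<lambda>t. f t x) \<theta> = 0"
proof (induction j arbitrary: \<theta>)
  case 0
  then show ?case using f_eq_0[OF _ x] by simp
next
  case (Suc j)
  have "((\<lambda>t. 0) has_real_derivative (deriv ^^ Suc j) (\<lambda>t. f t x) \<theta>) (at \<theta>)"
    by (rule has_field_derivative_transform_within_open[OF f_deriv open_Theta])
      (use Suc in auto)
  then show ?case using DERIV_unique[OF _ DERIV_const] by blast
qed

text \<open>Both integrals are derivatives of functions that are constant on \<open>\<Theta>\<close>.\<close>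

lemma integral_f_deriv_eq_0:
  assumes "\<theta> \<in> \<Theta>"
  shows "(\<integral>x. deriv (\<lambda>t. f t x) \<theta> \<partial>\<nu>) = 0" and "(\<integral>x. deriv (deriv (\<lambda>t. f t x)) \<theta> \<partial>\<nu>) = 0"
proof -
  have 1: "(\<integral>x. deriv (\<lambda>t. f t x) s \<partial>\<nu>) = 0" if s: "s \<in> \<Theta>" for s
  proof -
    have total: "(\<integral>x. f t x \<partial>\<nu>) = 1" if "t \<in> \<Theta>" for t
      using integral_law[OF that, of "\<lambda>x. 1"] prob_space.prob_space[OF law_prob_space[OF that]] by simp
    have "((\<lambda>t. 1) has_real_derivative (\<integral>x. deriv (\<lambda>t. f t x) s \<partial>\<nu>)) (at s)"
      by (rule has_field_derivative_transform_within_open[OF integral_f_deriv[OF s, of 0, simplified] open_Theta s])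
        (simp add: total)
    then show ?thesis using DERIV_unique[OF _ DERIV_const] by blast
  qed
  show "(\<integral>x. deriv (\<lambda>t. f t x) \<theta> \<partial>\<nu>) = 0" by (rule 1[OF assms])
  have "((\<lambda>t. 0) has_real_derivative (\<integral>x. deriv (deriv (\<lambda>t. f t x)) \<theta> \<partial>\<nu>)) (at \<theta>)"
    by (rule has_field_derivative_transform_within_open[OF integral_f_deriv[OF assms, of 1, simplified] open_Theta assms])
      (simp add: 1)
  then show "(\<integral>x. deriv (deriv (\<lambda>t. f t x)) \<theta> \<partial>\<nu>) = 0" using DERIV_unique[OF _ DERIV_const] by blast
qed

lemma score_mean:
  assumes "\<theta> \<in> \<Theta>"
  shows "integrable (\<mu> \<theta>) (score \<theta>)" and "(\<integral>x. score \<theta> x \<partial>\<mu> \<theta>) = 0"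
proof -
  have *: "f \<theta> x * score \<theta> x = deriv (\<lambda>t. f t x) \<theta>" for x
    using f_pos_iff[OF assms, of x] f_deriv_outside_support[of x \<theta> 1] assms
    by (cases "x \<in> \<X>") (auto simp: score_def f_eq_0)
  show "integrable (\<mu> \<theta>) (score \<theta>)"
    using integrable_f_deriv[OF assms, of 0] by (simp add: integrable_law_iff assms score_measurable *)
  show "(\<integral>x. score \<theta> x \<partial>\<mu> \<theta>) = 0"
    using integral_f_deriv_eq_0(1)[OF assms] by (simp add: integral_law assms score_measurable *)
qed

lemma fisher_info_eq:
  assumes "\<theta> \<in> \<Theta>"
  shows "fisher_info \<nu> f \<theta> = (\<integral>x. (score \<theta> x)\<^sup>2 \<partial>\<mu> \<theta>)"
proof -
  have *: "(deriv (\<lambda>t. ln (f t x)) \<theta>)\<^sup>2 = (score \<theta> x)\<^sup>2" for x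
  proof (cases "x \<in> \<X>")
    case True
    then show ?thesis using DERIV_imp_deriv[OF log_f_deriv[OF assms True]] by simp
  next
    case False
    have "((\<lambda>t. ln (f t x)) has_real_derivative 0) (at \<theta>)"
      by (rule has_field_derivative_transform_within_open[OF DERIV_const[of "ln 0"] open_Theta assms])
        (simp add: f_eq_0[OF _ False])
    from DERIV_imp_deriv[OF this] show ?thesis by (simp add: score_def f_eq_0[OF assms False])
  qed
  show ?thesis by (simp only: fisher_info_def *)
qed

lemma score_square_integrable:
  assumes "\<theta> \<in> \<Theta>" "fisher_info \<nu> f \<theta> > 0"
  shows "integrable (\<mu> \<theta>) (\<lambda>x. (score \<theta> x)\<^sup>2)"
  using assms not_integrable_integral_eq[of "\<mu> \<theta>" "\<lambda>x. (score \<theta> x)\<^sup>2"] by (auto simp: fisher_info_eq)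

text \<open>The score has mean zero and a positive second moment.\<close>

lemma score_takes_both_signs:
  assumes "\<theta> \<in> \<Theta>" "fisher_info \<nu> f \<theta> > 0"
  shows "\<not> (AE x in \<mu> \<theta>. score \<theta> x \<le> 0)" "\<not> (AE x in \<mu> \<theta>. score \<theta> x \<ge> 0)"
proof -
  have nz: "\<not> (AE x in \<mu> \<theta>. score \<theta> x = 0)"
  proof
    assume "AE x in \<mu> \<theta>. score \<theta> x = 0"
    then have "AE x in \<mu> \<theta>. (score \<theta> x)\<^sup>2 = 0" by eventually_elim simp
    then have "(\<integral>x. (score \<theta> x)\<^sup>2 \<partial>\<mu> \<theta>) = 0"
      using integral_cong_AE[of "\<lambda>x. (score \<theta> x)\<^sup>2" "\<mu> \<theta>" "\<lambda>x. 0"] score_square_integrable[OF assms] by simp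
    with assms show False by (simp add: fisher_info_eq)
  qed
  note score_mean[OF assms(1)]
  then show "\<not> (AE x in \<mu> \<theta>. score \<theta> x \<ge> 0)"
    using integral_nonneg_eq_0_iff_AE[of "\<mu> \<theta>" "score \<theta>"] nz by auto
  show "\<not> (AE x in \<mu> \<theta>. score \<theta> x \<le> 0)"
    using integral_nonneg_eq_0_iff_AE[of "\<mu> \<theta>" "\<lambda>x. - score \<theta> x"] nz score_mean[OF assms(1)] by auto
qed

definition score_deriv :: "real \<Rightarrow> real \<Rightarrow> real" where
  "score_deriv \<theta> x = deriv (deriv (\<lambda>t. f t x)) \<theta> / f \<theta> x - (score \<theta> x)\<^sup>2"

lemma score_has_derivative:
  assumes "\<theta> \<in> \<Theta>" "x \<in> \<X>"
  shows "((\<lambda>t. score t x) has_real_derivative score_deriv \<theta> x) (at \<theta>)"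
proof -
  have f: "((\<lambda>t. f t x) has_real_derivative deriv (\<lambda>t. f t x) \<theta>) (at \<theta>)"
    "(deriv (\<lambda>t. f t x) has_real_derivative deriv (deriv (\<lambda>t. f t x)) \<theta>) (at \<theta>)"
    using f_deriv[OF assms(1), of 0 x] f_deriv[OF assms(1), of 1 x] by simp_all
  have nz: "f \<theta> x \<noteq> 0" using f_pos_iff[OF assms(1), of x] assms(2) by simp
  have "score_deriv \<theta> x = (deriv (deriv (\<lambda>t. f t x)) \<theta> * f \<theta> x
      - deriv (\<lambda>t. f t x) \<theta> * deriv (\<lambda>t. f t x) \<theta>) / (f \<theta> x * f \<theta> x)"
    using nz by (simp add: score_deriv_def score_def divide_simps power2_eq_square)
  then show ?thesis
    unfolding score_def using DERIV_divide[OF f(2) f(1) nz] by simp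
qed

text \<open>The derivative of the score is \<open>f'' / f\<close> minus the square of the score, and \<open>f''\<close>
  integrates to zero.\<close>

lemma second_Bartlett_identity:
  assumes t: "\<theta> \<in> \<Theta>" and i: "fisher_info \<nu> f \<theta> > 0"
  shows "integrable (\<mu> \<theta>) (score_deriv \<theta>)"
    and "(\<integral>x. score_deriv \<theta> x \<partial>\<mu> \<theta>) = - fisher_info \<nu> f \<theta>"
proof -
  let ?k = "\<lambda>x. deriv (deriv (\<lambda>t. f t x)) \<theta> / f \<theta> x"
  have d2: "integrable \<nu> (\<lambda>x. deriv (deriv (\<lambda>t. f t x)) \<theta>)"
    using integrable_f_deriv[OF t, of 1] by simp
  then have m: "?k \<in> borel_measurable borel"
    using f_measurable[OF t] borel_measurable_integrable[OF d2] unfolding measurable_nu_iff by measurable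
  have *: "f \<theta> x * ?k x = deriv (deriv (\<lambda>t. f t x)) \<theta>" for x
    using f_pos_iff[OF t, of x] f_deriv_outside_support[of x \<theta> 2] t
    by (cases "x \<in> \<X>") (auto simp: f_eq_0 numeral_2_eq_2)
  have k: "integrable (\<mu> \<theta>) ?k" "(\<integral>x. ?k x \<partial>\<mu> \<theta>) = 0"
    using d2 integral_f_deriv_eq_0(2)[OF t]
    unfolding integrable_law_iff[OF t m] integral_law[OF t m] * by simp_all
  note s = score_square_integrable[OF t i]
  show "integrable (\<mu> \<theta>) (score_deriv \<theta>)"
    unfolding score_deriv_def[abs_def] by (intro Bochner_Integration.integrable_diff k s)
  show "(\<integral>x. score_deriv \<theta> x \<partial>\<mu> \<theta>) = - fisher_info \<nu> f \<theta>"
    unfolding score_deriv_def fisher_info_eq[OF t] using k s by simp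
qed

end

section \<open>Estimators that average an observable\<close>

locale averaging_mle = parametric_family a b \<Theta> \<X> \<nu> f + prob_space M
  for a b :: ereal and \<Theta> \<X> :: "real set" and \<nu> :: "real measure" and f :: "real \<Rightarrow> real \<Rightarrow> real"
    and M :: "'a measure" +
  fixes \<theta>\<^sub>0 :: real and X :: "nat \<Rightarrow> 'a \<Rightarrow> real" and q g :: "real \<Rightarrow> real"
  assumes \<theta>\<^sub>0: "\<theta>\<^sub>0 \<in> \<Theta>"
    and ind: "indep_vars (\<lambda>_. borel) X UNIV"
    and dist: "\<And>i. distributed M \<nu> (X i) (\<lambda>x. ennreal (f \<theta>\<^sub>0 x))"
    and R4: "cond_R4 \<nu> f \<Theta>"
    and q_inj: "inj_on q \<Theta>"
    and q_diff: "times_differentiable_on 2 q \<Theta>"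
    and q'_nonzero: "\<And>\<theta>. \<theta> \<in> \<Theta> \<Longrightarrow> deriv q \<theta> \<noteq> 0"
    and g_measurable[measurable]: "g \<in> borel_measurable borel"
    and average: "\<And>k. k \<ge> 1 \<Longrightarrow>
           AE \<omega> in M. q (mle f \<Theta> \<X> k (\<lambda>i. X i \<omega>)) = (\<Sum>i<k. g (X i \<omega>)) / real k"
begin

lemma q_deriv:
  assumes "\<theta> \<in> \<Theta>"
  shows "(q has_real_derivative deriv q \<theta>) (at \<theta>)"
    and "(deriv q has_real_derivative deriv (deriv q) \<theta>) (at \<theta>)"
proof -
  have "(deriv ^^ j) q differentiable (at \<theta>)" if "j < 2" for j
    using q_diff assms that unfolding times_differentiable_on_def by blast
  from this[of 0] this[of 1] show "(q has_real_derivative deriv q \<theta>) (at \<theta>)"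
    "(deriv q has_real_derivative deriv (deriv q) \<theta>) (at \<theta>)"
    by (simp_all add: DERIV_deriv_iff_real_differentiable)
qed

lemma X_measurable[measurable]: "random_variable borel (X i)"
  using ind by (auto simp: indep_vars_def)

lemma distr_X: "distr M borel (X i) = \<mu> \<theta>\<^sub>0"
proof -
  have "distr M borel (X i) = distr M \<nu> (X i)" by (rule distr_cong) (auto simp: sets_nu)
  also have "\<dots> = \<mu> \<theta>\<^sub>0" using dist[of i] by (simp add: distributed_def law_def)
  finally show ?thesis .
qed

lemma AE_X:
  assumes "AE x in \<mu> \<theta>\<^sub>0. P x" shows "AE \<omega> in M. P (X i \<omega>)"
  by (rule AE_distrD[OF X_measurable[of i]]) (unfold distr_X, rule assms)

lemma AE_all_in_support: "AE \<omega> in M. \<forall>i<k. X i \<omega> \<in> \<X>"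
  using AE_X[OF AE_law_in_support[OF \<theta>\<^sub>0]] by (simp add: AE_all_countable)

text \<open>Both signs equal the sign of \<open>T - \<theta>\<close>. The factor \<open>\<sigma>\<close> covers increasing and decreasing \<open>q\<close>.\<close>

lemma AE_sgn_score_sum:
  fixes k :: nat
  assumes mono: "\<sigma> \<noteq> 0" "\<And>s t. s \<in> \<Theta> \<Longrightarrow> t \<in> \<Theta> \<Longrightarrow> s < t \<Longrightarrow> \<sigma> * q s < \<sigma> * q t"
    and t: "\<theta> \<in> \<Theta>" and k: "k \<ge> 1"
  shows "AE \<omega> in M. sgn (\<Sum>i<k. score \<theta> (X i \<omega>)) = sgn (\<Sum>i<k. \<sigma> * (g (X i \<omega>) - q \<theta>))"
  using average[OF k] AE_all_in_support[of k]
proof eventually_elim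
  case (elim \<omega>)
  let ?m = "mle f \<Theta> \<X> k (\<lambda>i. X i \<omega>)"
  have supp: "(\<lambda>i. X i \<omega>) \<in> {..<k} \<rightarrow> \<X>" using elim by auto
  note m = mle_in_Theta_and_sgn_score[OF k supp]
  have "(\<Sum>i<k. \<sigma> * (g (X i \<omega>) - q \<theta>)) = real k * (\<sigma> * q ?m - \<sigma> * q \<theta>)"
    using k elim(1) by (simp add: sum_subtractf field_simps flip: sum_distrib_left)
  also have "sgn \<dots> = sgn (\<sigma> * q ?m - \<sigma> * q \<theta>)" using k by (simp add: sgn_mult)
  also have "\<dots> = sgn (?m - \<theta>)"
    using mono(2)[OF m(1) t] mono(2)[OF t m(1)] by (cases ?m \<theta> rule: linorder_cases) auto
  finally show ?case using m(2)[OF t] by simp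
qed

lemma score_proportional:
  assumes t: "\<theta> \<in> \<Theta>"
  obtains c where "c \<noteq> 0" "AE x in \<mu> \<theta>\<^sub>0. score \<theta> x = c * (g x - q \<theta>)"
proof -
  have "continuous_on \<Theta> q"
    by (rule DERIV_continuous_on[OF has_field_derivative_at_within[OF q_deriv(1)]])
  then have "strict_mono_on \<Theta> q \<or> strict_antimono_on \<Theta> q"
    using injective_eq_monotone_map[OF is_interval_Theta] q_inj by blast
  then have "\<exists>\<sigma>::real. \<sigma> \<noteq> 0 \<and> (\<forall>s\<in>\<Theta>. \<forall>t\<in>\<Theta>. s < t \<longrightarrow> \<sigma> * q s < \<sigma> * q t)"
  proof
    assume "strict_mono_on \<Theta> q"
    then show ?thesis by (intro exI[of _ 1]) (auto simp: monotone_on_def)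
  next
    assume "strict_antimono_on \<Theta> q"
    then show ?thesis by (intro exI[of _ "-1"]) (auto simp: monotone_on_def)
  qed
  then obtain \<sigma> :: real where \<sigma>: "\<sigma> \<noteq> 0" "\<And>s t. s \<in> \<Theta> \<Longrightarrow> t \<in> \<Theta> \<Longrightarrow> s < t \<Longrightarrow> \<sigma> * q s < \<sigma> * q t"
    by blast
  have sg: "\<not> (AE x in \<mu> \<theta>\<^sub>0. score \<theta> x \<le> 0)" "\<not> (AE x in \<mu> \<theta>\<^sub>0. score \<theta> x \<ge> 0)"
    using score_takes_both_signs[OF t] R4 t by (auto simp: cond_R4_def AE_law_iff[OF t] AE_law_iff[OF \<theta>\<^sub>0])
  obtain c where "c > 0" "AE x in \<mu> \<theta>\<^sub>0. score \<theta> x = c * (\<sigma> * (g x - q \<theta>))"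
    using proportional_of_equal_signs[OF ind distr_X score_measurable[OF t] _
        AE_sgn_score_sum[OF \<sigma> t] sg] by auto
  then show thesis using \<sigma>(1) by (intro that[of "c * \<sigma>"]) (auto simp: mult.assoc)
qed

text \<open>Proportionality holds at every parameter, but off a null set that depends on it. Therefore
  the derivative of the score at \<open>\<theta>\<^sub>0\<close> is taken along a sequence \<open>\<theta>\<^sub>0 + \<delta> k\<close>, for which one null set
  suffices. The factors \<open>c\<close> are differentiable along the sequence because they can be recovered from
  two fixed observations with different values of \<open>g\<close>. This gives
  \<open>s' = d * (g - q \<theta>\<^sub>0) - c \<theta>\<^sub>0 * q' \<theta>\<^sub>0\<close> for some number \<open>d\<close>; the first term has mean zero.\<close>

lemma score_proportional_at_true_value:
  defines "i \<equiv> fisher_info \<nu> f \<theta>\<^sub>0"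
  shows "AE x in \<mu> \<theta>\<^sub>0. score \<theta>\<^sub>0 x = i / deriv q \<theta>\<^sub>0 * (g x - q \<theta>\<^sub>0)"
proof -
  have "\<forall>t\<in>\<Theta>. \<exists>c. c \<noteq> 0 \<and> (AE x in \<mu> \<theta>\<^sub>0. score t x = c * (g x - q t))"
    using score_proportional by metis
  then obtain c where c: "\<And>t. t \<in> \<Theta> \<Longrightarrow> c t \<noteq> 0 \<and> (AE x in \<mu> \<theta>\<^sub>0. score t x = c t * (g x - q t))"
    by metis
  obtain e where e: "e > 0" "\<And>y. \<bar>y - \<theta>\<^sub>0\<bar> < e \<Longrightarrow> y \<in> \<Theta>"
    using open_Theta \<theta>\<^sub>0 unfolding open_dist dist_real_def by blast
  define \<delta> where "\<delta> k = e / real (k + 2)" for k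
  have \<delta>pos: "\<delta> k > 0" for k using e by (simp add: \<delta>_def)
  have \<delta>0: "\<delta> \<longlonglongrightarrow> 0" unfolding \<delta>_def by real_asymp
  have in\<Theta>: "\<theta>\<^sub>0 + \<delta> k \<in> \<Theta>" for k
  proof (rule e(2))
    have "e / real (k + 2) < e / 1" using e(1) by (intro divide_strict_left_mono) auto
    then show "\<bar>\<theta>\<^sub>0 + \<delta> k - \<theta>\<^sub>0\<bar> < e" using \<delta>pos[of k] by (simp add: \<delta>_def)
  qed
  have "AE x in \<mu> \<theta>\<^sub>0. x \<in> \<X> \<and> score \<theta>\<^sub>0 x = c \<theta>\<^sub>0 * (g x - q \<theta>\<^sub>0)
      \<and> (\<forall>k. score (\<theta>\<^sub>0 + \<delta> k) x = c (\<theta>\<^sub>0 + \<delta> k) * (g x - q (\<theta>\<^sub>0 + \<delta> k)))"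
    using c in\<Theta> \<theta>\<^sub>0 AE_law_in_support[OF \<theta>\<^sub>0] by (simp add: AE_all_countable)
  then obtain N where N: "N \<in> null_sets (\<mu> \<theta>\<^sub>0)"
    and good: "\<And>x. x \<notin> N \<Longrightarrow> x \<in> \<X> \<and> score \<theta>\<^sub>0 x = c \<theta>\<^sub>0 * (g x - q \<theta>\<^sub>0)
      \<and> (\<forall>k. score (\<theta>\<^sub>0 + \<delta> k) x = c (\<theta>\<^sub>0 + \<delta> k) * (g x - q (\<theta>\<^sub>0 + \<delta> k)))"
    by (rule AE_E3) (use sets_eq_imp_space_eq[OF law_sets] in auto)
  have AEN: "AE x in \<mu> \<theta>\<^sub>0. x \<notin> N" by (rule AE_not_in[OF N])
  have ipos: "i > 0" using R4 \<theta>\<^sub>0 by (simp add: i_def cond_R4_def)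
  note signs = score_takes_both_signs[OF \<theta>\<^sub>0 ipos[unfolded i_def]]
  have "\<exists>x. x \<notin> N \<and> score \<theta>\<^sub>0 x > 0"
  proof (rule ccontr)
    assume *: "\<not> ?thesis"
    have "AE x in \<mu> \<theta>\<^sub>0. score \<theta>\<^sub>0 x \<le> 0" using AEN by eventually_elim (use * in force)
    with signs(1) show False by contradiction
  qed
  then obtain x where x: "x \<notin> N" "score \<theta>\<^sub>0 x > 0" by blast
  have "\<exists>x. x \<notin> N \<and> score \<theta>\<^sub>0 x < 0"
  proof (rule ccontr)
    assume *: "\<not> ?thesis"
    have "AE x in \<mu> \<theta>\<^sub>0. score \<theta>\<^sub>0 x \<ge> 0" using AEN by eventually_elim (use * in force)
    with signs(2) show False by contradiction
  qed
  then obtain y where y: "y \<notin> N" "score \<theta>\<^sub>0 y < 0" by blast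
  have gxy: "g x - g y \<noteq> 0" using good[OF x(1)] good[OF y(1)] x y by auto
  define r where "r k = (c (\<theta>\<^sub>0 + \<delta> k) - c \<theta>\<^sub>0) / \<delta> k" for k
  define s where "s k = (q (\<theta>\<^sub>0 + \<delta> k) - q \<theta>\<^sub>0) / \<delta> k" for k
  have seq: "(\<lambda>k. (F (\<theta>\<^sub>0 + \<delta> k) - F \<theta>\<^sub>0) / \<delta> k) \<longlonglongrightarrow> D" if "(F has_real_derivative D) (at \<theta>\<^sub>0)" for F D
  proof -
    have "filterlim \<delta> (at 0) sequentially"
      using \<delta>0 \<delta>pos by (intro filterlim_atI) (auto simp: less_imp_neq[symmetric])
    with that show ?thesis unfolding DERIV_def by (rule filterlim_compose)
  qed
  have s: "s \<longlonglongrightarrow> deriv q \<theta>\<^sub>0" unfolding s_def by (rule seq[OF q_deriv(1)[OF \<theta>\<^sub>0]])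
  \<comment> \<open>discrete product rule for \<open>c \<theta> * (g z - q \<theta>)\<close>\<close>
  have quot: "(score (\<theta>\<^sub>0 + \<delta> k) z - score \<theta>\<^sub>0 z) / \<delta> k = r k * (g z - q \<theta>\<^sub>0) - c (\<theta>\<^sub>0 + \<delta> k) * s k"
    if "z \<notin> N" for z k
  proof -
    have "score (\<theta>\<^sub>0 + \<delta> k) z - score \<theta>\<^sub>0 z
        = (c (\<theta>\<^sub>0 + \<delta> k) - c \<theta>\<^sub>0) * (g z - q \<theta>\<^sub>0)
          - c (\<theta>\<^sub>0 + \<delta> k) * (q (\<theta>\<^sub>0 + \<delta> k) - q \<theta>\<^sub>0)"
      using good[OF that] by (simp add: algebra_simps)
    then show ?thesis by (simp add: r_def s_def diff_divide_distrib[of "_ * _" "_ * _"])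
  qed
  have lim: "(\<lambda>k. r k * (g z - q \<theta>\<^sub>0) - c (\<theta>\<^sub>0 + \<delta> k) * s k) \<longlonglongrightarrow> score_deriv \<theta>\<^sub>0 z" if "z \<notin> N" for z
    unfolding quot[OF that, symmetric]
    by (rule seq[OF score_has_derivative[OF \<theta>\<^sub>0]]) (use good[OF that] in blast)
  \<comment> \<open>The terms with \<open>c\<close> cancel in the difference of the quotients at \<open>x\<close> and \<open>y\<close>.\<close>
  define d where "d = (score_deriv \<theta>\<^sub>0 x - score_deriv \<theta>\<^sub>0 y) / (g x - g y)"
  have r: "r \<longlonglongrightarrow> d"
  proof -
    have "(\<lambda>k. ((r k * (g x - q \<theta>\<^sub>0) - c (\<theta>\<^sub>0 + \<delta> k) * s k) - (r k * (g y - q \<theta>\<^sub>0) - c (\<theta>\<^sub>0 + \<delta> k) * s k)) / (g x - g y))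
       \<longlonglongrightarrow> d"
      unfolding d_def by (intro tendsto_divide tendsto_diff lim x y tendsto_const gxy)
    moreover have "((r k * (g x - q \<theta>\<^sub>0) - c (\<theta>\<^sub>0 + \<delta> k) * s k) - (r k * (g y - q \<theta>\<^sub>0) - c (\<theta>\<^sub>0 + \<delta> k) * s k)) / (g x - g y) = r k" for k
      using gxy by (simp add: divide_eq_eq) (simp add: algebra_simps)
    ultimately show ?thesis by simp
  qed
  have ck: "(\<lambda>k. c (\<theta>\<^sub>0 + \<delta> k)) \<longlonglongrightarrow> c \<theta>\<^sub>0"
  proof -
    have "(\<lambda>k. c \<theta>\<^sub>0 + \<delta> k * r k) \<longlonglongrightarrow> c \<theta>\<^sub>0 + 0 * d"
      by (intro tendsto_intros \<delta>0 r)
    moreover have "c \<theta>\<^sub>0 + \<delta> k * r k = c (\<theta>\<^sub>0 + \<delta> k)" for k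
      using \<delta>pos[of k] by (simp add: r_def)
    ultimately show ?thesis by simp
  qed
  have sd: "score_deriv \<theta>\<^sub>0 z = d * (g z - q \<theta>\<^sub>0) - c \<theta>\<^sub>0 * deriv q \<theta>\<^sub>0" if "z \<notin> N" for z
    using LIMSEQ_unique[OF lim[OF that]] tendsto_diff[OF tendsto_mult[OF r tendsto_const] tendsto_mult[OF ck s]]
    by blast
  interpret law: prob_space "\<mu> \<theta>\<^sub>0" by (rule law_prob_space[OF \<theta>\<^sub>0])
  have c0: "c \<theta>\<^sub>0 \<noteq> 0" using c \<theta>\<^sub>0 by blast
  have "AE z in \<mu> \<theta>\<^sub>0. score_deriv \<theta>\<^sub>0 z = d / c \<theta>\<^sub>0 * score \<theta>\<^sub>0 z - c \<theta>\<^sub>0 * deriv q \<theta>\<^sub>0"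
    using AEN
  proof eventually_elim
    case (elim z)
    then show ?case using good[OF elim] sd[OF elim] c0 by simp
  qed
  then have "(\<integral>z. score_deriv \<theta>\<^sub>0 z \<partial>\<mu> \<theta>\<^sub>0) = (\<integral>z. d / c \<theta>\<^sub>0 * score \<theta>\<^sub>0 z - c \<theta>\<^sub>0 * deriv q \<theta>\<^sub>0 \<partial>\<mu> \<theta>\<^sub>0)"
    using second_Bartlett_identity(1)[OF \<theta>\<^sub>0 ipos[unfolded i_def]] score_mean(1)[OF \<theta>\<^sub>0]
    by (intro integral_cong_AE) auto
  also have "\<dots> = - (c \<theta>\<^sub>0 * deriv q \<theta>\<^sub>0)"
    using score_mean[OF \<theta>\<^sub>0] law.prob_space by simp
  finally have "i = c \<theta>\<^sub>0 * deriv q \<theta>\<^sub>0"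
    using second_Bartlett_identity(2)[OF \<theta>\<^sub>0 ipos[unfolded i_def]] by (simp add: i_def)
  then have "i / deriv q \<theta>\<^sub>0 = c \<theta>\<^sub>0" using q'_nonzero[OF \<theta>\<^sub>0] by simp
  then show ?thesis using c[OF \<theta>\<^sub>0] by simp
qed

text \<open>The standardised observations coincide almost surely with the score divided by
  \<open>sqrt i\<close>.\<close>

lemma standardized_observation_moments:
  defines "Y \<equiv> \<lambda>k \<omega>. sqrt (fisher_info \<nu> f \<theta>\<^sub>0) / deriv q \<theta>\<^sub>0 * (g (X k \<omega>) - q \<theta>\<^sub>0)"
  shows "expectation (Y 0) = 0" and "expectation (\<lambda>\<omega>. (Y 0 \<omega>)\<^sup>2) = 1"
proof -
  define i where "i = fisher_info \<nu> f \<theta>\<^sub>0"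
  have ipos: "i > 0" using R4 \<theta>\<^sub>0 by (simp add: i_def cond_R4_def)
  have Ym[measurable]: "random_variable borel (Y 0)" unfolding Y_def by measurable
  have sm[measurable]: "score \<theta>\<^sub>0 \<in> borel_measurable borel" by (rule score_measurable[OF \<theta>\<^sub>0])
  have "AE \<omega> in M. Y 0 \<omega> = score \<theta>\<^sub>0 (X 0 \<omega>) / sqrt i"
    using AE_X[OF score_proportional_at_true_value, of 0]
  proof eventually_elim
    case (elim \<omega>)
    have "sqrt i = i / sqrt i" using ipos by (simp add: real_div_sqrt)
    then have "Y 0 \<omega> = i / sqrt i / deriv q \<theta>\<^sub>0 * (g (X 0 \<omega>) - q \<theta>\<^sub>0)" by (simp add: Y_def i_def)
    then show ?case using elim by (simp add: i_def)
  qed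
  note Y = this
  have "expectation (Y 0) = expectation (\<lambda>\<omega>. score \<theta>\<^sub>0 (X 0 \<omega>) / sqrt i)"
    by (rule integral_cong_AE) (use Y in auto)
  also have "\<dots> = expectation (\<lambda>\<omega>. score \<theta>\<^sub>0 (X 0 \<omega>)) / sqrt i" by simp
  also have "expectation (\<lambda>\<omega>. score \<theta>\<^sub>0 (X 0 \<omega>)) = 0"
    using integral_distr[of "X 0" M borel "score \<theta>\<^sub>0"] score_mean(2)[OF \<theta>\<^sub>0] by (simp add: distr_X)
  finally show "expectation (Y 0) = 0" by simp
  have "expectation (\<lambda>\<omega>. (Y 0 \<omega>)\<^sup>2) = expectation (\<lambda>\<omega>. (score \<theta>\<^sub>0 (X 0 \<omega>))\<^sup>2 / i)"
  proof (rule integral_cong_AE)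
    show "AE \<omega> in M. (Y 0 \<omega>)\<^sup>2 = (score \<theta>\<^sub>0 (X 0 \<omega>))\<^sup>2 / i"
      using Y by eventually_elim (use ipos in \<open>simp add: power_divide\<close>)
  qed auto
  also have "\<dots> = expectation (\<lambda>\<omega>. (score \<theta>\<^sub>0 (X 0 \<omega>))\<^sup>2) / i" by simp
  also have "expectation (\<lambda>\<omega>. (score \<theta>\<^sub>0 (X 0 \<omega>))\<^sup>2) = i"
    using integral_distr[of "X 0" M borel "\<lambda>x. (score \<theta>\<^sub>0 x)\<^sup>2"] fisher_info_eq[OF \<theta>\<^sub>0]
    by (simp add: distr_X i_def)
  finally show "expectation (\<lambda>\<omega>. (Y 0 \<omega>)\<^sup>2) = 1" using ipos by simp
qed

end

section \<open>The bound for the maximum likelihood estimator\<close>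

text \<open>A violation at \<open>x\<close> persists in a neighbourhood of \<open>x\<close>, which has positive measure.\<close>

lemma continuous_le_ess_norm:
  fixes F :: "real \<Rightarrow> real"
  assumes cont: "continuous_on UNIV F"
  shows "ennreal \<bar>F x\<bar> \<le> ess_norm F"
proof (rule ccontr)
  assume less: "\<not> ?thesis"
  have "AE t in lebesgue. ennreal \<bar>F t\<bar> \<le> ess_norm F"
    unfolding ess_norm_def by (rule esssup_AE)
  then have ae: "AE t in lborel. ennreal \<bar>F t\<bar> \<le> ess_norm F"
    by (simp add: AE_completion_iff)
  obtain C where C: "ess_norm F = ennreal C" "0 \<le> C"
    using less by (cases "ess_norm F") auto
  define U where "U = {t. C < \<bar>F t\<bar>}"
  have U: "open U" "x \<in> U"
    using cont less C unfolding U_def by (auto intro!: open_Collect_less continuous_intros simp: not_le ennreal_less_iff)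
  then obtain d where d: "d > 0" "ball x d \<subseteq> U" by (auto simp: open_contains_ball)
  have "AE t in lborel. t \<notin> U" using ae C by (simp add: U_def not_less)
  then have "emeasure lborel U = 0" using U(1) by (intro AE_iff_measurable[THEN iffD1, of U]) auto
  moreover have "emeasure lborel {x - d<..<x + d} \<le> emeasure lborel U"
    using d(2) U(1) by (intro emeasure_mono) (auto simp: ball_eq_greaterThanLessThan)
  ultimately show False using d(1) by simp
qed

context averaging_mle
begin

definition standardized_observation :: "nat \<Rightarrow> 'a \<Rightarrow> real" where
  "standardized_observation k \<omega> = sqrt (fisher_info \<nu> f \<theta>\<^sub>0) / deriv q \<theta>\<^sub>0 * (g (X k \<omega>) - q \<theta>\<^sub>0)"

lemma fisher_info_pos: "fisher_info \<nu> f \<theta>\<^sub>0 > 0"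
  using R4 \<theta>\<^sub>0 by (simp add: cond_R4_def)

lemma stein_bound_average:
  assumes int3: "integrable M (\<lambda>\<omega>. \<bar>g (X 0 \<omega>) - q \<theta>\<^sub>0\<bar> ^ 3)"
    and lip: "\<And>x y. \<bar>h y - h x\<bar> \<le> L * \<bar>y - x\<bar>"
    and n: "n \<ge> 1"
  shows "\<bar>expectation (\<lambda>\<omega>. h ((\<Sum>i<n. standardized_observation i \<omega>) / sqrt n)) - (\<integral>z. h z \<partial>std_normal_distribution)\<bar>
    \<le> L / sqrt n * (2 + fisher_info \<nu> f \<theta>\<^sub>0 powr (3/2) / \<bar>deriv q \<theta>\<^sub>0\<bar> ^ 3 *
                      expectation (\<lambda>\<omega>. \<bar>g (X 0 \<omega>) - q \<theta>\<^sub>0\<bar> ^ 3))"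
proof -
  define i where "i = fisher_info \<nu> f \<theta>\<^sub>0"
  define k where "k x = sqrt i / deriv q \<theta>\<^sub>0 * (g x - q \<theta>\<^sub>0)" for x
  have km[measurable]: "k \<in> borel_measurable borel" unfolding k_def[abs_def] by measurable
  have Yk: "standardized_observation j = (\<lambda>\<omega>. k (X j \<omega>))" for j
    by (simp add: fun_eq_iff standardized_observation_def k_def i_def)
  have powr: "i powr (3/2) = sqrt i ^ 3"
    using fisher_info_pos by (simp add: i_def powr_half_sqrt[symmetric] powr_realpow[symmetric] powr_powr)
  have abs3: "\<bar>k x\<bar> ^ 3 = i powr (3/2) / \<bar>deriv q \<theta>\<^sub>0\<bar> ^ 3 * \<bar>g x - q \<theta>\<^sub>0\<bar> ^ 3" for x
    using fisher_info_pos unfolding powr by (simp add: k_def abs_mult power_mult_distrib power_divide i_def)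
  have distrY: "distr M borel (\<lambda>\<omega>. k (X j \<omega>)) = distr (\<mu> \<theta>\<^sub>0) borel k" for j
    using distr_distr[of k borel borel "X j" M] unfolding distr_X by (simp add: comp_def)
  have "\<bar>expectation (\<lambda>\<omega>. h ((\<Sum>i<n. standardized_observation i \<omega>) / sqrt n)) - (\<integral>z. h z \<partial>std_normal_distribution)\<bar>
    \<le> L / sqrt n * (2 + expectation (\<lambda>\<omega>. \<bar>standardized_observation 0 \<omega>\<bar> ^ 3))"
  proof (rule stein_bound_iid[OF _ _ _ _ _ lip n])
    show "indep_vars (\<lambda>_. borel) standardized_observation UNIV"
      unfolding Yk by (rule indep_vars_compose2[OF ind]) simp
    show "distr M borel (standardized_observation j) = distr M borel (standardized_observation 0)" for j
      unfolding Yk distrY ..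
    show "integrable M (\<lambda>\<omega>. \<bar>standardized_observation 0 \<omega>\<bar> ^ 3)"
      unfolding Yk abs3 by (intro integrable_mult_right int3)
    show "expectation (standardized_observation 0) = 0" "expectation (\<lambda>\<omega>. (standardized_observation 0 \<omega>)\<^sup>2) = 1"
      using standardized_observation_moments by (simp_all add: standardized_observation_def[abs_def])
  qed
  also have "expectation (\<lambda>\<omega>. \<bar>standardized_observation 0 \<omega>\<bar> ^ 3)
      = i powr (3/2) / \<bar>deriv q \<theta>\<^sub>0\<bar> ^ 3 * expectation (\<lambda>\<omega>. \<bar>g (X 0 \<omega>) - q \<theta>\<^sub>0\<bar> ^ 3)"
    unfolding Yk abs3 by simp
  finally show ?thesis by (simp add: i_def)
qed

lemma AE_average_eq:
  assumes n: "n \<ge> 1"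
  shows "AE \<omega> in M. (\<Sum>i<n. standardized_observation i \<omega>) / sqrt n
    = sqrt (real n * fisher_info \<nu> f \<theta>\<^sub>0) / deriv q \<theta>\<^sub>0 * (q (mle f \<Theta> \<X> n (\<lambda>i. X i \<omega>)) - q \<theta>\<^sub>0)"
  using average[OF n]
proof eventually_elim
  case (elim \<omega>)
  define i where "i = fisher_info \<nu> f \<theta>\<^sub>0"
  define S where "S = (\<Sum>i<n. g (X i \<omega>))"
  have "real n / sqrt (real n) = sqrt (real n)" using n by (simp add: real_div_sqrt)
  have "(\<Sum>j<n. standardized_observation j \<omega>) = sqrt i / deriv q \<theta>\<^sub>0 * (S - real n * q \<theta>\<^sub>0)"
    unfolding standardized_observation_def sum_distrib_left[symmetric]
    by (simp add: i_def S_def sum_subtractf)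
  also have "S - real n * q \<theta>\<^sub>0 = real n * (S / real n - q \<theta>\<^sub>0)" using n by (simp add: field_simps)
  finally have "(\<Sum>j<n. standardized_observation j \<omega>) / sqrt n
     = sqrt i / deriv q \<theta>\<^sub>0 * (real n / sqrt (real n)) * (S / real n - q \<theta>\<^sub>0)" by simp
  also have "real n / sqrt (real n) = sqrt (real n)" by fact
  finally show ?case
    unfolding elim by (simp add: real_sqrt_mult i_def S_def mult.commute)
qed

text \<open>If \<open>|m - \<theta>\<^sub>0| \<ge> \<epsilon>\<close>, the difference is at most \<open>2 C \<le> 2 C * (m - \<theta>\<^sub>0)\<^sup>2 / \<epsilon>\<^sup>2\<close>. Otherwise the
  segment from \<open>\<theta>\<^sub>0\<close> to \<open>m\<close> lies in \<open>\<Theta>\<close>, and the Lipschitz bound applies to the second order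
  remainder of \<open>q\<close>. If \<open>q\<close> is the identity, the two arguments of \<open>h\<close> agree.\<close>

lemma delta_method_pointwise:
  fixes h :: "real \<Rightarrow> real"
  assumes m: "m \<in> \<Theta>"
    and ep: "\<epsilon> > 0" "{\<theta>\<^sub>0 - \<epsilon><..<\<theta>\<^sub>0 + \<epsilon>} \<subseteq> \<Theta>"
    and L: "\<And>x y. \<bar>h y - h x\<bar> \<le> L * \<bar>y - x\<bar>"
    and C: "\<And>x. \<bar>h x\<bar> \<le> C"
    and s: "s \<ge> 0"
  shows "ennreal \<bar>h (s * (m - \<theta>\<^sub>0)) - h (s / deriv q \<theta>\<^sub>0 * (q m - q \<theta>\<^sub>0))\<bar> \<le> ennreal ((m - \<theta>\<^sub>0)\<^sup>2) *
     (2 * (ennreal C / ennreal (\<epsilon>\<^sup>2)) * of_bool (\<exists>\<theta>\<in>\<Theta>. q \<theta> \<noteq> \<theta>)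
          + ennreal L * ennreal s / ennreal (2 * \<bar>deriv q \<theta>\<^sub>0\<bar>) *
            (SUP \<theta>\<in>{\<theta>\<in>\<Theta>. \<bar>\<theta> - \<theta>\<^sub>0\<bar> \<le> \<epsilon>}. ennreal \<bar>deriv (deriv q) \<theta>\<bar>))"
    (is "ennreal ?d \<le> ennreal (?D\<^sup>2) * (?P + ?Q)")
proof -
  have L0: "0 \<le> L" using L[of 1 0] by simp
  have C0: "0 \<le> C" using C[of 0] by simp
  have q': "deriv q \<theta>\<^sub>0 \<noteq> 0" by (rule q'_nonzero[OF \<theta>\<^sub>0])
  consider "\<forall>\<theta>\<in>\<Theta>. q \<theta> = \<theta>" | "m = \<theta>\<^sub>0"
    | "\<exists>\<theta>\<in>\<Theta>. q \<theta> \<noteq> \<theta>" "\<bar>?D\<bar> \<ge> \<epsilon>" | "\<bar>?D\<bar> < \<epsilon>" "m \<noteq> \<theta>\<^sub>0"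
    by (metis not_less)
  then show ?thesis
  proof cases
    case 1
    have "(q has_real_derivative 1) (at \<theta>\<^sub>0)"
      by (rule has_field_derivative_transform_within_open[OF DERIV_ident open_Theta \<theta>\<^sub>0]) (use 1 in auto)
    then have "deriv q \<theta>\<^sub>0 = 1" by (rule DERIV_imp_deriv)
    then show ?thesis using 1 m \<theta>\<^sub>0 by simp
  next
    case 2
    then show ?thesis by simp
  next
    case 3
    have "?d \<le> 2 * C" using C[of "s * ?D"] C[of "s / deriv q \<theta>\<^sub>0 * (q m - q \<theta>\<^sub>0)"] by linarith
    also have "2 * C = \<epsilon>\<^sup>2 * (2 * (C / \<epsilon>\<^sup>2))" using ep by simp
    also have "\<dots> \<le> ?D\<^sup>2 * (2 * (C / \<epsilon>\<^sup>2))"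
      using 3(2) ep C0 by (intro mult_right_mono) (auto simp: abs_le_square_iff[symmetric])
    finally have "ennreal ?d \<le> ennreal (?D\<^sup>2 * (2 * (C / \<epsilon>\<^sup>2)))" by (rule ennreal_leI)
    also have "\<dots> = ennreal (?D\<^sup>2) * ?P"
    proof -
      have "ennreal (?D\<^sup>2 * (2 * (C / \<epsilon>\<^sup>2))) = ennreal (?D\<^sup>2) * (ennreal 2 * ennreal (C / \<epsilon>\<^sup>2))"
        using C0 by (subst ennreal_mult, simp, simp, subst ennreal_mult) auto
      then show ?thesis using ep(1) C0 3(1) by (simp add: divide_ennreal)
    qed
    also have "\<dots> \<le> ennreal (?D\<^sup>2) * (?P + ?Q)" by (intro mult_left_mono) auto
    finally show ?thesis .
  next
    case 4
    define lo hi where "lo = min m \<theta>\<^sub>0" and "hi = max m \<theta>\<^sub>0"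
    have seg: "t \<in> \<Theta> \<and> \<bar>t - \<theta>\<^sub>0\<bar> \<le> \<epsilon>" if "lo \<le> t" "t \<le> hi" for t
    proof -
      have "t \<in> {\<theta>\<^sub>0 - \<epsilon><..<\<theta>\<^sub>0 + \<epsilon>}" using that 4(1) ep(1) by (auto simp: lo_def hi_def)
      with ep(2) show ?thesis by auto
    qed
    have "\<exists>t. (if m < \<theta>\<^sub>0 then m < t \<and> t < \<theta>\<^sub>0 else \<theta>\<^sub>0 < t \<and> t < m) \<and>
        q m = (\<Sum>j<2. (deriv ^^ j) q \<theta>\<^sub>0 / fact j * (m - \<theta>\<^sub>0) ^ j) + (deriv ^^ 2) q t / fact 2 * (m - \<theta>\<^sub>0) ^ 2"
    proof (rule Taylor[of 2 "\<lambda>j. (deriv ^^ j) q" q lo hi \<theta>\<^sub>0 m])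
      show "\<forall>j t. j < 2 \<and> lo \<le> t \<and> t \<le> hi \<longrightarrow> ((deriv ^^ j) q has_real_derivative (deriv ^^ Suc j) q t) (at t)"
        using q_deriv seg by (auto simp: less_2_cases_iff)
    qed (use 4 in \<open>auto simp: lo_def hi_def\<close>)
    then obtain t where between: "if m < \<theta>\<^sub>0 then m < t \<and> t < \<theta>\<^sub>0 else \<theta>\<^sub>0 < t \<and> t < m"
      and expansion: "q m = (\<Sum>j<2. (deriv ^^ j) q \<theta>\<^sub>0 / fact j * (m - \<theta>\<^sub>0) ^ j)
        + (deriv ^^ 2) q t / fact 2 * (m - \<theta>\<^sub>0) ^ 2"
      by blast
    have t: "lo \<le> t" "t \<le> hi" using between by (auto simp: lo_def hi_def split: if_splits)
    have eq: "q m = q \<theta>\<^sub>0 + deriv q \<theta>\<^sub>0 * ?D + deriv (deriv q) t / 2 * ?D\<^sup>2"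
      unfolding expansion by (simp add: numeral_2_eq_2)
    let ?a = "\<bar>deriv (deriv q) t\<bar>"
    have "s / deriv q \<theta>\<^sub>0 * (q m - q \<theta>\<^sub>0) - s * ?D = s / (2 * deriv q \<theta>\<^sub>0) * deriv (deriv q) t * ?D\<^sup>2"
      unfolding eq using q' by (simp add: field_simps)
    then have "\<bar>s / deriv q \<theta>\<^sub>0 * (q m - q \<theta>\<^sub>0) - s * ?D\<bar> = s / (2 * \<bar>deriv q \<theta>\<^sub>0\<bar>) * ?a * ?D\<^sup>2"
      using s by (simp add: abs_mult)
    then have "?d \<le> L * (s / (2 * \<bar>deriv q \<theta>\<^sub>0\<bar>) * ?a * ?D\<^sup>2)"
      using L[of "s / deriv q \<theta>\<^sub>0 * (q m - q \<theta>\<^sub>0)" "s * ?D"] by (metis abs_minus_commute)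
    also have "\<dots> = ?D\<^sup>2 * (L * s / (2 * \<bar>deriv q \<theta>\<^sub>0\<bar>) * ?a)" by simp
    finally have "ennreal ?d \<le> ennreal (?D\<^sup>2 * (L * s / (2 * \<bar>deriv q \<theta>\<^sub>0\<bar>) * ?a))" by (rule ennreal_leI)
    also have "\<dots> = ennreal (?D\<^sup>2) * (ennreal L * ennreal s / ennreal (2 * \<bar>deriv q \<theta>\<^sub>0\<bar>) * ennreal ?a)"
    proof -
      have "ennreal (?D\<^sup>2 * (L * s / (2 * \<bar>deriv q \<theta>\<^sub>0\<bar>) * ?a))
          = ennreal (?D\<^sup>2) * (ennreal (L * s / (2 * \<bar>deriv q \<theta>\<^sub>0\<bar>)) * ennreal ?a)"
        using L0 s by (subst ennreal_mult, simp, simp, subst ennreal_mult) auto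
      also have "ennreal (L * s / (2 * \<bar>deriv q \<theta>\<^sub>0\<bar>)) = ennreal L * ennreal s / ennreal (2 * \<bar>deriv q \<theta>\<^sub>0\<bar>)"
        using L0 s q' by (subst divide_ennreal[symmetric]) (auto simp: ennreal_mult)
      finally show ?thesis .
    qed
    also have "\<dots> \<le> ennreal (?D\<^sup>2) * ?Q"
      using seg[OF t] by (intro mult_left_mono SUP_upper) auto
    also have "\<dots> \<le> ennreal (?D\<^sup>2) * (?P + ?Q)" by (intro mult_left_mono) auto
    finally show ?thesis .
  qed
qed

end

theorem theorem2p2:
  fixes a b :: ereal
    and \<Theta> \<X> :: "real set"
    and \<nu> :: "real measure"
    and f :: "real \<Rightarrow> real \<Rightarrow> real"
    and \<theta>\<^sub>0 \<epsilon> :: real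
    and M :: "'a measure"
    and X :: "nat \<Rightarrow> 'a \<Rightarrow> real"
    and q g h h' :: "real \<Rightarrow> real"
    and n :: nat
  assumes "a < b" and "\<Theta> = einterval a b"
    and "density_family \<nu> \<Theta> \<X> f"
    and "\<theta>\<^sub>0 \<in> \<Theta>"
    and "prob_space M"
    and "prob_space.indep_vars M (\<lambda>_. borel) X UNIV"
    and "\<And>i. distributed M \<nu> (X i) (\<lambda>x. ennreal (f \<theta>\<^sub>0 x))"
    and "\<And>k x. k \<ge> 1 \<Longrightarrow> x \<in> {..<k} \<rightarrow> \<X> \<Longrightarrow>
           cond_A1 f \<Theta> k x \<and> cond_A2 f a b k x \<and> cond_A3 f \<Theta> k x"
    and "cond_R1 f \<Theta>" and "cond_R2 \<nu> f \<Theta>" and "cond_R3 \<nu> f \<Theta> \<X>" and "cond_R4 \<nu> f \<Theta>"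
    and "inj_on q \<Theta>"
    and "times_differentiable_on 2 q \<Theta>"
    and "\<And>\<theta>. \<theta> \<in> \<Theta> \<Longrightarrow> deriv q \<theta> \<noteq> 0"
    and "g \<in> borel_measurable borel"
    and "\<And>k. k \<ge> 1 \<Longrightarrow>
           AE \<omega> in M. q (mle f \<Theta> \<X> k (\<lambda>i. X i \<omega>)) = (\<Sum>i<k. g (X i \<omega>)) / real k"
    and "integrable M (\<lambda>\<omega>. \<bar>g (X 0 \<omega>) - q \<theta>\<^sub>0\<bar> ^ 3)"
    and "R3_radius \<nu> f \<Theta> \<X> \<theta>\<^sub>0 \<epsilon>"
    and "{\<theta>\<^sub>0 - \<epsilon><..<\<theta>\<^sub>0 + \<epsilon>} \<subseteq> \<Theta>"
    and "abs_continuous h" and "bounded (range h)"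
    and "AE x in lborel. (h has_real_derivative h' x) (at x)"
    and "n \<ge> 1"
  shows
    "ennreal \<bar>(\<integral>\<omega>. h (sqrt (real n * fisher_info \<nu> f \<theta>\<^sub>0) *
                        (mle f \<Theta> \<X> n (\<lambda>i. X i \<omega>) - \<theta>\<^sub>0)) \<partial>M)
              - (\<integral>z. h z \<partial>std_normal_distribution)\<bar>
     \<le> ess_norm h' / ennreal (sqrt (real n)) *
         ennreal (2 + fisher_info \<nu> f \<theta>\<^sub>0 powr (3/2) / \<bar>deriv q \<theta>\<^sub>0\<bar> ^ 3 *
                      (\<integral>\<omega>. \<bar>g (X 0 \<omega>) - q \<theta>\<^sub>0\<bar> ^ 3 \<partial>M))
       + (\<integral>\<^sup>+\<omega>. ennreal ((mle f \<Theta> \<X> n (\<lambda>i. X i \<omega>) - \<theta>\<^sub>0)\<^sup>2) \<partial>M) *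
         (2 * (ess_norm h / ennreal (\<epsilon>\<^sup>2)) * of_bool (\<exists>\<theta>\<in>\<Theta>. q \<theta> \<noteq> \<theta>)
          + ess_norm h' * ennreal (sqrt (real n * fisher_info \<nu> f \<theta>\<^sub>0)) /
              ennreal (2 * \<bar>deriv q \<theta>\<^sub>0\<bar>) *
            (SUP \<theta>\<in>{\<theta>\<in>\<Theta>. \<bar>\<theta> - \<theta>\<^sub>0\<bar> \<le> \<epsilon>}. ennreal \<bar>deriv (deriv q) \<theta>\<bar>))"
proof -
  interpret averaging_mle a b \<Theta> \<X> \<nu> f M \<theta>\<^sub>0 X q g
    using assms(5)
    by (intro averaging_mle.intro parametric_family.intro averaging_mle_axioms.intro assms)
  define i where "i = fisher_info \<nu> f \<theta>\<^sub>0"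
  define B where "B = i powr (3/2) / \<bar>deriv q \<theta>\<^sub>0\<bar> ^ 3 * (\<integral>\<omega>. \<bar>g (X 0 \<omega>) - q \<theta>\<^sub>0\<bar> ^ 3 \<partial>M)"
  have B0: "B \<ge> 0" unfolding B_def by (intro mult_nonneg_nonneg Bochner_Integration.integral_nonneg) auto
  have ipos: "i > 0" using fisher_info_pos by (simp add: i_def)
  have n0: "real n > 0" using assms(24) by simp
  show ?thesis
  proof (cases "ess_norm h'")
    case top
    \<comment> \<open>The right-hand side is infinite, because \<open>2 + B\<close> is positive.\<close>
    have "ess_norm h' / ennreal (sqrt (real n)) * ennreal (2 + B) = top"
      using B0 unfolding top by (simp add: ennreal_top_divide ennreal_top_mult)
    then show ?thesis unfolding B_def i_def by simp
  next
    case (real L)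
    have "AE x in lebesgue. ennreal \<bar>h' x\<bar> \<le> ess_norm h'"
      unfolding ess_norm_def by (rule esssup_AE)
    then have "AE x in lborel. \<bar>h' x\<bar> \<le> L"
      using real by (simp add: AE_completion_iff)
    then have lip: "\<bar>h y - h x\<bar> \<le> L * \<bar>y - x\<bar>" for x y
      by (rule abs_continuous_imp_lipschitz[OF assms(21,23)])
    have "L-lipschitz_on UNIV h"
      using lip real(1) by (intro lipschitz_onI) (auto simp: dist_real_def abs_minus_commute)
    then have cont: "continuous_on UNIV h" by (rule lipschitz_on_continuous_on)
    then have hm[measurable]: "h \<in> borel_measurable borel" by (rule borel_measurable_continuous_onI)
    obtain C' where C': "\<And>x. \<bar>h x\<bar> \<le> C'" using assms(22) by (auto simp: bounded_iff)
    have "ess_norm h \<le> ennreal C'"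
      unfolding ess_norm_def by (rule esssup_I) (use C' in \<open>auto intro!: ennreal_leI measurable_completion\<close>)
    then obtain C where C: "ess_norm h = ennreal C" "0 \<le> C" by (cases "ess_norm h") (auto simp: top_unique)
    have hC: "\<bar>h x\<bar> \<le> C" for x
      using continuous_le_ess_norm[OF cont, of x] C by simp
    define s where "s = sqrt (real n * i)"
    have s0: "s \<ge> 0" using ipos by (simp add: s_def)
    define T where "T \<omega> = mle f \<Theta> \<X> n (\<lambda>i. X i \<omega>)" for \<omega>
    define W where "W \<omega> = (\<Sum>i<n. standardized_observation i \<omega>) / sqrt n" for \<omega>
    have Tm[measurable]: "T \<in> borel_measurable M"
      unfolding T_def[abs_def] by (rule mle_measurable[OF assms(24)]) simp
    have Wm[measurable]: "W \<in> borel_measurable M"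
      unfolding W_def[abs_def] standardized_observation_def by measurable
    have hint: "integrable M (\<lambda>\<omega>. h (V \<omega>))" if "V \<in> borel_measurable M" for V
      using that hC by (intro integrable_const_bound[of _ C]) auto
    define K where "K = 2 * (ess_norm h / ennreal (\<epsilon>\<^sup>2)) * of_bool (\<exists>\<theta>\<in>\<Theta>. q \<theta> \<noteq> \<theta>)
          + ess_norm h' * ennreal s / ennreal (2 * \<bar>deriv q \<theta>\<^sub>0\<bar>) *
            (SUP \<theta>\<in>{\<theta>\<in>\<Theta>. \<bar>\<theta> - \<theta>\<^sub>0\<bar> \<le> \<epsilon>}. ennreal \<bar>deriv (deriv q) \<theta>\<bar>)"
    have ep: "\<epsilon> > 0" using assms(19) by (simp add: R3_radius_def)
    have pointwise: "AE \<omega> in M. ennreal \<bar>h (s * (T \<omega> - \<theta>\<^sub>0)) - h (W \<omega>)\<bar> \<le> ennreal ((T \<omega> - \<theta>\<^sub>0)\<^sup>2) * K"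
      using AE_average_eq[OF assms(24)] AE_all_in_support[of n]
    proof eventually_elim
      case (elim \<omega>)
      have "T \<omega> \<in> \<Theta>"
        unfolding T_def by (rule mle_in_Theta_and_sgn_score(1)[OF assms(24)]) (use elim in auto)
      from delta_method_pointwise[OF this ep assms(20) lip hC s0]
      show ?case
        unfolding K_def C(1) real(2) W_def elim(1) by (simp add: T_def s_def i_def)
    qed
    have part1: "ennreal \<bar>expectation (\<lambda>\<omega>. h (s * (T \<omega> - \<theta>\<^sub>0))) - expectation (\<lambda>\<omega>. h (W \<omega>))\<bar>
        \<le> (\<integral>\<^sup>+\<omega>. ennreal ((T \<omega> - \<theta>\<^sub>0)\<^sup>2) \<partial>M) * K"
    proof -
      have int: "integrable M (\<lambda>\<omega>. h (s * (T \<omega> - \<theta>\<^sub>0)) - h (W \<omega>))"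
        by (intro Bochner_Integration.integrable_diff hint) measurable
      have "ennreal \<bar>expectation (\<lambda>\<omega>. h (s * (T \<omega> - \<theta>\<^sub>0))) - expectation (\<lambda>\<omega>. h (W \<omega>))\<bar>
          = ennreal \<bar>expectation (\<lambda>\<omega>. h (s * (T \<omega> - \<theta>\<^sub>0)) - h (W \<omega>))\<bar>"
        by (subst Bochner_Integration.integral_diff) (auto intro!: hint)
      also have "\<dots> \<le> ennreal (expectation (\<lambda>\<omega>. \<bar>h (s * (T \<omega> - \<theta>\<^sub>0)) - h (W \<omega>)\<bar>))"
        by (intro ennreal_leI integral_abs_bound)
      also have "\<dots> = (\<integral>\<^sup>+\<omega>. ennreal \<bar>h (s * (T \<omega> - \<theta>\<^sub>0)) - h (W \<omega>)\<bar> \<partial>M)"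
        using int by (subst nn_integral_eq_integral) auto
      also have "\<dots> \<le> (\<integral>\<^sup>+\<omega>. ennreal ((T \<omega> - \<theta>\<^sub>0)\<^sup>2) * K \<partial>M)"
        by (rule nn_integral_mono_AE[OF pointwise])
      also have "\<dots> = (\<integral>\<^sup>+\<omega>. ennreal ((T \<omega> - \<theta>\<^sub>0)\<^sup>2) \<partial>M) * K"
        by (rule nn_integral_multc) measurable
      finally show ?thesis .
    qed
    have part2: "ennreal \<bar>expectation (\<lambda>\<omega>. h (W \<omega>)) - (\<integral>z. h z \<partial>std_normal_distribution)\<bar>
        \<le> ess_norm h' / ennreal (sqrt (real n)) * ennreal (2 + B)"
    proof -
      have "ennreal \<bar>expectation (\<lambda>\<omega>. h (W \<omega>)) - (\<integral>z. h z \<partial>std_normal_distribution)\<bar>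
         \<le> ennreal (L / sqrt (real n) * (2 + B))"
        unfolding W_def B_def i_def
        by (intro ennreal_leI stein_bound_average assms(18,24) lip)
      also have "\<dots> = ess_norm h' / ennreal (sqrt (real n)) * ennreal (2 + B)"
        unfolding real(2) using real(1) n0 B0 by (subst ennreal_mult) (auto simp: divide_ennreal)
      finally show ?thesis .
    qed
    have "ennreal \<bar>expectation (\<lambda>\<omega>. h (s * (T \<omega> - \<theta>\<^sub>0))) - (\<integral>z. h z \<partial>std_normal_distribution)\<bar>
      \<le> ennreal (\<bar>expectation (\<lambda>\<omega>. h (W \<omega>)) - (\<integral>z. h z \<partial>std_normal_distribution)\<bar>
         + \<bar>expectation (\<lambda>\<omega>. h (s * (T \<omega> - \<theta>\<^sub>0))) - expectation (\<lambda>\<omega>. h (W \<omega>))\<bar>)"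
      by (intro ennreal_leI) linarith
    also have "\<dots> = ennreal \<bar>expectation (\<lambda>\<omega>. h (W \<omega>)) - (\<integral>z. h z \<partial>std_normal_distribution)\<bar>
         + ennreal \<bar>expectation (\<lambda>\<omega>. h (s * (T \<omega> - \<theta>\<^sub>0))) - expectation (\<lambda>\<omega>. h (W \<omega>))\<bar>"
      by (rule ennreal_plus) auto
    also have "\<dots> \<le> ess_norm h' / ennreal (sqrt (real n)) * ennreal (2 + B)
        + (\<integral>\<^sup>+\<omega>. ennreal ((T \<omega> - \<theta>\<^sub>0)\<^sup>2) \<partial>M) * K"
      by (intro add_mono part1 part2)
    finally show ?thesis unfolding T_def K_def B_def s_def i_def .
  qed
qed

end
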